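(* Consider the setting of the context and assume (A1), (A2) and (A3). Let $f(X_i)=\theta^*$ for all $i$. Then there are three constants $a_0$, $a_1$ and $a_2$, depending on $r$, $u_0$ and $u$ only, such that the choice $$\mathfrak z_k=a_0+a_1\log\alpha^{-1}+a_2\,r\log(N_K/N_k)$$ of the critical values in the aggregation procedure ensures $$\sup_{\theta^*\in\Theta}\mathbf E_{\theta^*}\bigl|N_k\,\mathscr K(\widetilde\theta^{(k)},\widehat\theta^{(k)})\bigr|^r\le\alpha\tau_r\qquad\text{for all }k\le K.$$ In particular, $\mathbf E_{\theta^*}|N_K\,\mathscr K(\widetilde\theta^{(K)},\widehat\theta)|^r\le\alpha\tau_r$.
   Context: Model. The data $(X_i,Y_i)$, $i=1,\dots,n$, are independent, with $X_i\in\mathbb R^d$ and $Y_i\in\mathbb R$; given $X_i$, $Y_i\sim P_{f(X_i)}$, where $f:\mathbb R^d\to\Theta$ and $(P_\theta,\theta\in\Theta)$ is a parametric family dominated by a measure $P$. $\mathbf E_{\theta^*}$ denotes expectation when $f(X_i)=\theta^*$ for all $i$. (A1) $(P_\theta,\theta\in\Theta\subseteq\mathbb R)$ is an exponential family with natural parametrization: the densities are $p(y,\theta)=p(y)e^{yC(\theta)-B(\theta)}$, where $p(y)\ge0$, $B$ and $C$ are nondecreasing and continuously differentiable on $\Theta$, and $\mathbf E_\theta Y=\theta$ for all $\theta\in\Theta$. (A2) $\Theta$ is compact and convex, and the Fisher information $I(\theta)=\mathbf E_\theta|\partial\log p(Y,\theta)/\partial\theta|^2$ satisfies, for some $\varkappa\ge1$,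 $|I(\theta')/I(\theta'')|^{1/2}\le\varkappa$ for all $\theta',\theta''\in\Theta$. $\mathscr K(\theta,\theta')=\mathbf E_\theta\log\{p(Y,\theta)/p(Y,\theta')\}$ is the Kullback–Leibler divergence. Localizing schemes and weak estimates. For a fixed point $x$, weights $W^{(k)}=(w_1^{(k)},\dots,w_n^{(k)})$ with $w_i^{(k)}\in[0,1]$, $k=1,\dots,K$, are given, and $N_k=\sum_{i=1}^n w_i^{(k)}$. The local likelihood estimates of $f(x)$ are $\widetilde\theta^{(k)}=\arg\max_{\theta\in\Theta}\sum_i w_i^{(k)}\log p(Y_i,\theta)=\sum_i w_i^{(k)}Y_i/N_k$. (A3) $w_i^{(k)}\ge w_i^{(k')}$ for all $i$ and all $k>k'$; moreover, for some constants $0<u_0\le u<1$, $u_0\le N_{k-1}/N_k\le u$ for every $2\le k\le K$. Aggregation procedure. $K_{\mathrm{ag}}$ is a fixed monotone decreasing kernel with $0\le K_{\mathrm{ag}}\le1$, supported on $[0,1]$, such that $K_{\mathrm{ag}}(t)=1$ for $t\le b$ with some $b>0$. Given critical values $\mathfrak z_k>0$: set $\widehat\theta^{(1)}=\widetilde\theta^{(1)}$; for $k=2,\dots,K$ set $\widehat\theta^{(k)}=\gamma_k\widetilde\theta^{(k)}+(1-\gamma_k)\widehat\theta^{(k-1)}$ with $\gamma_k=K_{\mathrm{ag}}(\mathbf m^{(k)}/\mathfrak z_k)$ and $\mathbf m^{(k)}=N_k\mathscr K(\widetilde\theta^{(k)},\widehat\theta^{(k-1)})$. The final estimate is $\widehat\theta=\widehat\theta^{(K)}$.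 Global parameters. $r>0$ is the power of the loss and $\alpha>0$ plays a role similar to the level of a test; $\tau_r=2r\int_0^\infty z^{r-1}e^{-z}\,dz=2r\,\Gamma(r)$.
   Formalization: The constants a_0, a_1, a_2 may also depend on ϰ from (A2) and on b from the kernel K_ag (with r, u_0 and u alone the claim fails); the estimates θ̃^(k) are the arg max over Θ, which differs from the weighted mean when that mean lies outside Θ. *)

theory Defs
  imports "HOL-Probability.Probability"
begin

text \<open>
  A parametric family on the real line is given by a dominating measure \<open>P\<close>, a density
  \<open>q y \<theta>\<close> (written \<open>p(y,\<theta>)\<close> on paper) and a parameter set \<open>\<Theta>\<close>.
\<close>

definition family_law :: "real measure \<Rightarrow> (real \<Rightarrow> real \<Rightarrow> real) \<Rightarrow> real \<Rightarrow> real measure" where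
  "family_law P q \<theta> = density P (\<lambda>y. ennreal (q y \<theta>))"

definition dominated_family :: "real measure \<Rightarrow> (real \<Rightarrow> real \<Rightarrow> real) \<Rightarrow> real set \<Rightarrow> bool" where
  "dominated_family P q \<Theta> \<longleftrightarrow>
     sets P = sets borel \<and>
     (\<forall>\<theta>\<in>\<Theta>. (\<lambda>y. q y \<theta>) \<in> borel_measurable borel \<and> (\<forall>y. 0 \<le> q y \<theta>) \<and>
            prob_space (family_law P q \<theta>))"

definition continuously_differentiable_on :: "real set \<Rightarrow> (real \<Rightarrow> real) \<Rightarrow> bool" where
  "continuously_differentiable_on S g \<longleftrightarrow>
     (\<exists>g'. (\<forall>t\<in>S. (g has_real_derivative g' t) (at t within S)) \<and> continuous_on S g')"

text \<open>Condition (A1). Integrability of \<open>Y\<close> is explicit because the Bochner integral of a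
  non-integrable function is \<open>0\<close>.\<close>

definition exponential_family :: "real measure \<Rightarrow> (real \<Rightarrow> real \<Rightarrow> real) \<Rightarrow> real set \<Rightarrow> bool" where
  "exponential_family P q \<Theta> \<longleftrightarrow>
     (\<exists>p B C.
        (\<forall>y. 0 \<le> p y) \<and>
        mono_on \<Theta> B \<and> mono_on \<Theta> C \<and>
        continuously_differentiable_on \<Theta> B \<and> continuously_differentiable_on \<Theta> C \<and>
        (\<forall>\<theta>\<in>\<Theta>. \<forall>y. q y \<theta> = p y * exp (y * C \<theta> - B \<theta>))) \<and>
     (\<forall>\<theta>\<in>\<Theta>. integrable (family_law P q \<theta>) (\<lambda>y. y) \<and> (\<integral>y. y \<partial>family_law P q \<theta>) = \<theta>)"

text \<open>The score is the derivative relative to \<open>\<Theta>\<close>, hence one-sided at an endpoint of \<open>\<Theta>\<close>. Where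
  \<open>q y\<close> vanishes, \<open>ln 0 = 0\<close> gives it a junk value; that set is null under the law integrated over.\<close>

definition fisher_info :: "real measure \<Rightarrow> (real \<Rightarrow> real \<Rightarrow> real) \<Rightarrow> real set \<Rightarrow> real \<Rightarrow> real" where
  "fisher_info P q \<Theta> \<theta> =
     (\<integral>y. \<bar>vector_derivative (\<lambda>t. ln (q y t)) (at \<theta> within \<Theta>)\<bar>\<^sup>2 \<partial>family_law P q \<theta>)"

text \<open>Condition (A2). Positivity is what makes the ratio meaningful (division by \<open>0\<close> would yield
  \<open>0\<close>); it also forces the integral defining the Fisher information to exist.\<close>

definition fisher_regular ::
  "real \<Rightarrow> real measure \<Rightarrow> (real \<Rightarrow> real \<Rightarrow> real) \<Rightarrow> real set \<Rightarrow> bool" where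
  "fisher_regular \<kappa> P q \<Theta> \<longleftrightarrow>
     compact \<Theta> \<and> convex \<Theta> \<and>
     (\<forall>\<theta>\<in>\<Theta>. 0 < fisher_info P q \<Theta> \<theta>) \<and>
     (\<forall>\<theta>'\<in>\<Theta>. \<forall>\<theta>''\<in>\<Theta>. sqrt \<bar>fisher_info P q \<Theta> \<theta>' / fisher_info P q \<Theta> \<theta>''\<bar> \<le> \<kappa>)"

definition kullback :: "real measure \<Rightarrow> (real \<Rightarrow> real \<Rightarrow> real) \<Rightarrow> real \<Rightarrow> real \<Rightarrow> real" where
  "kullback P q \<theta> \<theta>' = (\<integral>y. ln (q y \<theta> / q y \<theta>') \<partial>family_law P q \<theta>)"

text \<open>\<open>R\<^sup>d\<close> as the space of functions on \<open>{..<d}\<close>, so that \<open>d\<close> can be quantified over inside a formula.\<close>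

abbreviation covariate_space :: "nat \<Rightarrow> (nat \<Rightarrow> real) measure" where
  "covariate_space d \<equiv> (\<Pi>\<^sub>M j\<in>{..<d}. borel)"

text \<open>\<open>Q\<close> is the law of a pair \<open>(X, Y)\<close> for which \<open>Y\<close> given \<open>X\<close> has law \<open>P\<^sub>\<theta>\<close> with \<open>\<theta> = f X\<close>; the law
  of \<open>X\<close> is arbitrary, so that deterministic designs are included.\<close>

definition observation_law ::
  "nat \<Rightarrow> real measure \<Rightarrow> (real \<Rightarrow> real \<Rightarrow> real) \<Rightarrow> ((nat \<Rightarrow> real) \<Rightarrow> real) \<Rightarrow>
   ((nat \<Rightarrow> real) \<times> real) measure \<Rightarrow> bool" where
  "observation_law d P q f Q \<longleftrightarrow>
     prob_space Q \<and> sets Q = sets (covariate_space d \<Otimes>\<^sub>M borel) \<and>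
     (\<forall>A\<in>sets (covariate_space d). \<forall>B\<in>sets borel.
        emeasure Q (A \<times> B) =
        (\<integral>\<^sup>+z. indicator A (fst z) * emeasure (family_law P q (f (fst z))) B \<partial>Q))"

text \<open>For every \<open>\<theta>\<in>\<Theta>\<close>, \<open>f \<theta>\<close> is a regression function with \<open>f \<theta> (X\<^sub>i) = \<theta>\<close> for all \<open>i\<close>, and
  \<open>Q \<theta> i\<close> is the law of the \<open>i\<close>-th observation under it. As the observations are independent, the
  expectation \<open>E\<^sub>\<theta>\<close> is the integral with respect to the product \<open>\<Pi>\<^sub>M i\<in>{1..n}. Q \<theta> i\<close>.\<close>

definition homogeneous_model ::
  "nat \<Rightarrow> nat \<Rightarrow> real measure \<Rightarrow> (real \<Rightarrow> real \<Rightarrow> real) \<Rightarrow> real set \<Rightarrow>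
   (real \<Rightarrow> (nat \<Rightarrow> real) \<Rightarrow> real) \<Rightarrow> (real \<Rightarrow> nat \<Rightarrow> ((nat \<Rightarrow> real) \<times> real) measure) \<Rightarrow> bool" where
  "homogeneous_model d n P q \<Theta> f Q \<longleftrightarrow>
     (\<forall>\<theta>\<in>\<Theta>. f \<theta> \<in> space (covariate_space d) \<rightarrow> \<Theta> \<and>
        (\<forall>i\<in>{1..n}. observation_law d P q (f \<theta>) (Q \<theta> i) \<and> (AE z in Q \<theta> i. f \<theta> (fst z) = \<theta>)))"

definition local_size :: "nat \<Rightarrow> (nat \<Rightarrow> nat \<Rightarrow> real) \<Rightarrow> nat \<Rightarrow> real" where
  "local_size n w k = (\<Sum>i=1..n. w k i)"

text \<open>Condition (A3), together with the requirement that the weights lie in \<open>[0,1]\<close>.\<close>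

definition localizing_scheme ::
  "real \<Rightarrow> real \<Rightarrow> nat \<Rightarrow> nat \<Rightarrow> (nat \<Rightarrow> nat \<Rightarrow> real) \<Rightarrow> bool" where
  "localizing_scheme u0 u n K w \<longleftrightarrow>
     (\<forall>k\<in>{1..K}. \<forall>i\<in>{1..n}. 0 \<le> w k i \<and> w k i \<le> 1) \<and>
     (\<forall>k\<in>{1..K}. \<forall>k'\<in>{1..K}. k' < k \<longrightarrow> (\<forall>i\<in>{1..n}. w k' i \<le> w k i)) \<and>
     (\<forall>k\<in>{2..K}. u0 \<le> local_size n w (k - 1) / local_size n w k \<and>
                 local_size n w (k - 1) / local_size n w k \<le> u)"

text \<open>The maximizer over \<open>\<Theta>\<close>. It equals the weighted mean of the observations if this mean lies in \<open>\<Theta>\<close>,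
  and otherwise the point of \<open>\<Theta>\<close> closest to it; the mean itself need not belong to the compact
  set \<open>\<Theta>\<close>, outside of which the divergence is undefined.\<close>

definition local_mle ::
  "(real \<Rightarrow> real \<Rightarrow> real) \<Rightarrow> real set \<Rightarrow> nat \<Rightarrow> (nat \<Rightarrow> real) \<Rightarrow> (nat \<Rightarrow> real) \<Rightarrow> real" where
  "local_mle q \<Theta> n wk y = arg_max_on (\<lambda>\<theta>. \<Sum>i=1..n. wk i * ln (q (y i) \<theta>)) \<Theta>"

definition aggregation_kernel :: "real \<Rightarrow> (real \<Rightarrow> real) \<Rightarrow> bool" where
  "aggregation_kernel b Kag \<longleftrightarrow>
     antimono_on {0..} Kag \<and>
     (\<forall>t\<ge>0. 0 \<le> Kag t \<and> Kag t \<le> 1) \<and>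
     (\<forall>t>1. Kag t = 0) \<and>
     (\<forall>t\<in>{0..b}. Kag t = 1)"

text \<open>Arguments: kernel, divergence, local sample sizes \<open>N\<^sub>k\<close>, critical values, weak estimates.
  Steps are numbered from \<open>1\<close>; the value at \<open>0\<close> is a dummy.\<close>

fun aggregated ::
  "(real \<Rightarrow> real) \<Rightarrow> (real \<Rightarrow> real \<Rightarrow> real) \<Rightarrow> (nat \<Rightarrow> real) \<Rightarrow> (nat \<Rightarrow> real) \<Rightarrow> (nat \<Rightarrow> real) \<Rightarrow> nat \<Rightarrow> real"
where
  "aggregated Kag D N z est 0 = 0"
| "aggregated Kag D N z est (Suc 0) = est 1"
| "aggregated Kag D N z est (Suc (Suc j)) =
     (let k = Suc (Suc j);
          prev = aggregated Kag D N z est (Suc j);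
          m = N k * D (est k) prev;
          \<gamma> = Kag (m / z k)
      in \<gamma> * est k + (1 - \<gamma>) * prev)"

text \<open>The risk \<open>E |N\<^sub>k D(est\<^sub>k, agg\<^sub>k)|\<^sup>r\<close> of the \<open>k\<close>-th aggregated estimate under the data law \<open>M\<close>,
  valued in \<open>[0,\<infinity>]\<close>, so that a finite upper bound includes finiteness of the moment.\<close>

definition aggregation_risk ::
  "real \<Rightarrow> real measure \<Rightarrow> (real \<Rightarrow> real \<Rightarrow> real) \<Rightarrow> real set \<Rightarrow> nat \<Rightarrow> (nat \<Rightarrow> nat \<Rightarrow> real) \<Rightarrow>
   (real \<Rightarrow> real) \<Rightarrow> (nat \<Rightarrow> real) \<Rightarrow> nat \<Rightarrow> (nat \<Rightarrow> (nat \<Rightarrow> real) \<times> real) measure \<Rightarrow> ennreal" where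
  "aggregation_risk r P q \<Theta> n w Kag z k M =
     (\<integral>\<^sup>+\<omega>. (let N = local_size n w;
               est = (\<lambda>j. local_mle q \<Theta> n (w j) (\<lambda>i. snd (\<omega> i)));
               agg = aggregated Kag (kullback P q) N z est
           in ennreal (\<bar>N k * kullback P q (est k) (agg k)\<bar> powr r)) \<partial>M)"

definition tau :: "real \<Rightarrow> real" where
  "tau r = 2 * r * Gamma r"

definition critical_value ::
  "real \<Rightarrow> real \<Rightarrow> real \<Rightarrow> real \<Rightarrow> real \<Rightarrow> nat \<Rightarrow> (nat \<Rightarrow> nat \<Rightarrow> real) \<Rightarrow> nat \<Rightarrow> nat \<Rightarrow> real" where
  "critical_value a0 a1 a2 r \<alpha> n w K k =
     a0 + a1 * ln (1 / \<alpha>) + a2 * r * ln (local_size n w K / local_size n w k)"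

end

theory Submission
  imports Defs
begin

text \<open>
  In the interior of \<open>\<Theta>\<close> the Fisher information is \<open>C'\<close>, and \<open>K(\<theta>,\<theta>')\<close> is the integral of
  \<open>(t - \<theta>) C'(t)\<close> over \<open>t\<close> from \<open>\<theta>\<close> to \<open>\<theta>'\<close>. The bound on the information ratio therefore makes it
  comparable to \<open>c (\<theta> - \<theta>')\<^sup>2\<close>, up to the factor \<open>\<kappa>\<^sup>4\<close>, and
  \<open>K\<close> behaves like a squared metric. Tilting \<open>P\<^sub>\<theta>\<close> to \<open>P\<^sub>s\<close> in a Chernoff bound shows that
  \<open>X\<^sub>l = c N\<^sub>l (est\<^sub>l - \<theta>)\<^sup>2\<close> has tails \<open>2 exp (-z)\<close>, hence \<open>E exp (X\<^sub>l / 2)\<close> is bounded by a constant.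

  If the loss at step \<open>k\<close> is nonzero, let \<open>j < k\<close> be the last step with \<open>agg\<^sub>j = est\<^sub>j\<close>. Step \<open>j + 1\<close> has
  not fully accepted \<open>est\<^sub>j\<^sub>+\<^sub>1\<close>, so \<open>X\<^sub>j\<close> or \<open>X\<^sub>j\<^sub>+\<^sub>1\<close> exceeds a multiple of the critical value, and \<open>agg\<^sub>k\<close>
  is a convex combination of \<open>est\<^sub>j, \<dots>, est\<^sub>k\<close>, so the loss is at most a multiple of
  \<open>(N\<^sub>k / N\<^sub>l) X\<^sub>l\<close> for some \<open>l\<close> in between. The logarithmic term in the critical value turns the
  small probability of the former into a power of \<open>N\<^sub>j / N\<^sub>K\<close>, which beats the factor \<open>(N\<^sub>k / N\<^sub>l)\<^sup>r\<close> of
  the latter and leaves a geometric series in \<open>j\<close> and \<open>l\<close>.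
\<close>

section \<open>Exponential families\<close>

text \<open>The witnesses of (A1) are fixed as \<open>p\<close>, \<open>B\<close>, \<open>C\<close>,
  so that tilting by \<open>exp ((C s - C \<theta>) * y)\<close> can be written down. Derivatives
  enter with \<open>regular_exp_family\<close>.\<close>

locale exp_family =
  fixes P :: "real measure" and q :: "real \<Rightarrow> real \<Rightarrow> real" and \<Theta> :: "real set"
    and p B C :: "real \<Rightarrow> real"
  assumes dominated: "dominated_family P q \<Theta>"
    and p_nonneg: "\<And>y. 0 \<le> p y"
    and q_eq: "\<And>\<theta> y. \<theta> \<in> \<Theta> \<Longrightarrow> q y \<theta> = p y * exp (y * C \<theta> - B \<theta>)"
    and mean_integrable: "\<And>\<theta>. \<theta> \<in> \<Theta> \<Longrightarrow> integrable (family_law P q \<theta>) (\<lambda>y. y)"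
    and mean_eq: "\<And>\<theta>. \<theta> \<in> \<Theta> \<Longrightarrow> (\<integral>y. y \<partial>family_law P q \<theta>) = \<theta>"
begin

lemma sets_P [measurable_cong]: "sets P = sets borel"
  using dominated by (simp add: dominated_family_def)

lemma q_measurable: "\<theta> \<in> \<Theta> \<Longrightarrow> (\<lambda>y. q y \<theta>) \<in> borel_measurable P"
  using dominated by (simp add: dominated_family_def measurable_cong_sets[OF sets_P refl])

lemma q_nonneg: "\<theta> \<in> \<Theta> \<Longrightarrow> 0 \<le> q y \<theta>"
  using dominated by (simp add: dominated_family_def)

lemma sets_family_law [measurable_cong]: "sets (family_law P q \<theta>) = sets borel"
  by (simp add: family_law_def sets_P)

lemma prob_space_family_law: "\<theta> \<in> \<Theta> \<Longrightarrow> prob_space (family_law P q \<theta>)"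
  using dominated by (simp add: dominated_family_def)

text \<open>The density \<open>q y \<theta>\<close> vanishes exactly where \<open>p y\<close> does.
  Off this null set logarithms of densities have their usual meaning.\<close>

lemma AE_p_pos:
  assumes "\<theta> \<in> \<Theta>"
  shows "AE y in family_law P q \<theta>. 0 < p y"
  unfolding family_law_def
  using assms q_measurable[OF assms] p_nonneg
  by (subst AE_density) (auto simp: q_eq zero_less_mult_iff intro!: AE_I2)

text \<open>Tilting: multiplying the density at \<open>\<theta>\<close> by the exponential gives
  \<open>exp (B s - B \<theta>)\<close> times the density at \<open>s\<close>, which has total mass
  one.\<close>

lemma nn_integral_exp:
  assumes "\<theta> \<in> \<Theta>" "s \<in> \<Theta>"
  shows "(\<integral>\<^sup>+y. ennreal (exp ((C s - C \<theta>) * y)) \<partial>family_law P q \<theta>) = ennreal (exp (B s - B \<theta>))"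
proof -
  have "(\<integral>\<^sup>+y. ennreal (exp ((C s - C \<theta>) * y)) \<partial>family_law P q \<theta>)
      = (\<integral>\<^sup>+y. ennreal (q y \<theta>) * ennreal (exp ((C s - C \<theta>) * y)) \<partial>P)"
    unfolding family_law_def using q_measurable[OF assms(1)]
    by (subst nn_integral_density) (auto simp: measurable_cong_sets[OF sets_P refl])
  also have "\<dots> = (\<integral>\<^sup>+y. ennreal (exp (B s - B \<theta>)) * ennreal (q y s) \<partial>P)"
    by (intro nn_integral_cong)
      (simp add: assms q_eq p_nonneg ennreal_mult[symmetric] exp_add[symmetric] exp_diff field_simps
        del: ennreal_mult)
  also have "\<dots> = ennreal (exp (B s - B \<theta>)) * (\<integral>\<^sup>+y. 1 \<partial>family_law P q s)"
    unfolding family_law_def using q_measurable[OF assms(2)]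
    by (simp add: nn_integral_cmult nn_integral_density emeasure_density)
  also have "(\<integral>\<^sup>+y. 1 \<partial>family_law P q s) = 1"
    using prob_space.emeasure_space_1[OF prob_space_family_law[OF assms(2)]] by simp
  finally show ?thesis by simp
qed

lemma has_bochner_integral_exp:
  assumes "\<theta> \<in> \<Theta>" "s \<in> \<Theta>"
  shows "has_bochner_integral (family_law P q \<theta>) (\<lambda>y. exp ((C s - C \<theta>) * y)) (exp (B s - B \<theta>))"
  using nn_integral_exp[OF assms]
  by (intro has_bochner_integral_nn_integral)
    (auto simp: measurable_cong_sets[OF sets_family_law refl])

text \<open>The same tilting, applied to \<open>E\<^sub>s Y = s\<close>. In this form the mean
  condition is later differentiated to find the second moment.\<close>

lemma has_bochner_integral_mean_exp:
  assumes "\<theta> \<in> \<Theta>" "s \<in> \<Theta>"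
  shows "has_bochner_integral (family_law P q \<theta>) (\<lambda>y. y * exp ((C s - C \<theta>) * y))
           (s * exp (B s - B \<theta>))"
proof -
  have "has_bochner_integral (family_law P q s) (\<lambda>y. y) s"
    using mean_integrable[OF assms(2)] mean_eq[OF assms(2)] by (simp add: has_bochner_integral_iff)
  then have "has_bochner_integral P (\<lambda>y. q y s * y) s"
    unfolding family_law_def has_bochner_integral_iff
    using q_measurable[OF assms(2)] q_nonneg[OF assms(2)]
    by (subst (asm) integrable_density, simp_all add: measurable_cong_sets[OF sets_P refl])
      (subst (asm) integral_density, simp_all add: measurable_cong_sets[OF sets_P refl])
  from has_bochner_integral_mult_right[OF this, of "exp (B s - B \<theta>)"]
  have "has_bochner_integral P (\<lambda>y. exp (B s - B \<theta>) * (q y s * y)) (exp (B s - B \<theta>) * s)"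
    by simp
  also have "(\<lambda>y. exp (B s - B \<theta>) * (q y s * y)) = (\<lambda>y. q y \<theta> *\<^sub>R (y * exp ((C s - C \<theta>) * y)))"
    by (rule ext) (simp add: assms q_eq exp_add[symmetric] exp_diff field_simps)
  finally show ?thesis
    unfolding family_law_def using q_measurable[OF assms(1)] q_nonneg[OF assms(1)]
    by (intro has_bochner_integral_density)
      (auto simp: measurable_cong_sets[OF sets_P refl] mult.commute)
qed

text \<open>The log-likelihood ratio is affine in \<open>y\<close>, so its expectation needs only
  total mass one and the mean \<open>\<theta>\<close>.\<close>

lemma kullback_eq:
  assumes "\<theta> \<in> \<Theta>" "s \<in> \<Theta>"
  shows "kullback P q \<theta> s = \<theta> * (C \<theta> - C s) - (B \<theta> - B s)"
proof -
  interpret prob_space "family_law P q \<theta>" by (rule prob_space_family_law[OF assms(1)])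
  have "kullback P q \<theta> s = (\<integral>y. (C \<theta> - C s) * y - (B \<theta> - B s) \<partial>family_law P q \<theta>)"
    unfolding kullback_def
  proof (intro integral_cong_AE)
    show "AE y in family_law P q \<theta>. ln (q y \<theta> / q y s) = (C \<theta> - C s) * y - (B \<theta> - B s)"
      using AE_p_pos[OF assms(1)]
      by eventually_elim (simp add: assms q_eq exp_diff[symmetric] algebra_simps)
    show "(\<lambda>y. ln (q y \<theta> / q y s)) \<in> borel_measurable (family_law P q \<theta>)"
      using q_measurable[OF assms(1)] q_measurable[OF assms(2)] by (simp add: family_law_def)
  qed (simp add: measurable_cong_sets[OF sets_family_law refl])
  also have "\<dots> = (C \<theta> - C s) * \<theta> - (B \<theta> - B s)"
    using mean_integrable[OF assms(1)] mean_eq[OF assms(1)] by (simp add: prob_space)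
  finally show ?thesis by (simp add: mult.commute)
qed

text \<open>Gibbs' inequality: \<open>1 + x \<le> exp x\<close> for the log-likelihood ratio of
  \<open>s\<close> to \<open>\<theta>\<close>, whose exponential has expectation one under
  \<open>P\<^sub>\<theta>\<close>.\<close>

lemma kullback_nonneg:
  assumes "\<theta> \<in> \<Theta>" "s \<in> \<Theta>"
  shows "0 \<le> kullback P q \<theta> s"
proof -
  interpret prob_space "family_law P q \<theta>" by (rule prob_space_family_law[OF assms(1)])
  let ?f = "\<lambda>y. (C s - C \<theta>) * y - (B s - B \<theta>)"
  note int = has_bochner_integral_exp[OF assms, unfolded has_bochner_integral_iff]
  have "(\<integral>y. ?f y + 1 \<partial>family_law P q \<theta>)
      \<le> (\<integral>y. exp (- (B s - B \<theta>)) * exp ((C s - C \<theta>) * y) \<partial>family_law P q \<theta>)"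
  proof (rule integral_mono)
    show "?f y + 1 \<le> exp (- (B s - B \<theta>)) * exp ((C s - C \<theta>) * y)" for y
      using exp_ge_add_one_self[of "?f y"] by (simp add: exp_add[symmetric] algebra_simps)
  qed (use int mean_integrable[OF assms(1)] in auto)
  also have "\<dots> = 1" using int by (simp, simp add: mult_exp_exp)
  finally show ?thesis
    using mean_integrable[OF assms(1)] mean_eq[OF assms(1)]
    by (simp add: prob_space kullback_eq assms algebra_simps)
qed

text \<open>If \<open>C \<theta> = C s\<close>, the tilting factor is constant; total mass one
  forces \<open>exp (B s - B \<theta>) = 1\<close>, and then both laws have the same mean.\<close>

lemma inj_on_C: "inj_on C \<Theta>"
proof (rule inj_onI)
  fix \<theta> s assume *: "\<theta> \<in> \<Theta>" "s \<in> \<Theta>" "C \<theta> = C s"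
  interpret prob_space "family_law P q \<theta>" by (rule prob_space_family_law[OF *(1)])
  have "exp (B s - B \<theta>) = 1"
    using has_bochner_integral_exp[OF *(1,2)] * by (simp add: has_bochner_integral_iff prob_space)
  then show "\<theta> = s"
    using has_bochner_integral_mean_exp[OF *(1,2)] * mean_eq[OF *(1)]
    by (simp add: has_bochner_integral_iff)
qed

end

section \<open>Two calculus estimates\<close>

text \<open>\<open>g\<close> falls to the left of \<open>\<theta>\<close> and rises to the right, so
  its minimum is \<open>g \<theta> = 0\<close>. Derivatives are taken in the interior; continuity
  covers the end points.\<close>

lemma nonneg_if_deriv_sign:
  fixes g d :: "real \<Rightarrow> real"
  assumes "\<theta> \<in> {lo..hi}" "s \<in> {lo..hi}" "continuous_on {lo..hi} g" "g \<theta> = 0"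
    and deriv: "\<And>x. lo < x \<Longrightarrow> x < hi \<Longrightarrow> (g has_real_derivative (x - \<theta>) * d x) (at x)"
    and d_nonneg: "\<And>x. lo < x \<Longrightarrow> x < hi \<Longrightarrow> 0 \<le> d x"
  shows "0 \<le> g s"
proof (cases "\<theta> \<le> s")
  case True
  have "g \<theta> \<le> g s"
  proof (rule DERIV_nonneg_imp_increasing_open[OF True])
    show "\<exists>y. (g has_real_derivative y) (at x) \<and> 0 \<le> y" if "\<theta> < x" "x < s" for x
      using deriv[of x] d_nonneg[of x] that assms(1,2) by (intro exI[of _ "(x - \<theta>) * d x"]) auto
    show "continuous_on {\<theta>..s} g" using assms by (auto intro: continuous_on_subset)
  qed
  then show ?thesis using assms by simp
next
  case False
  then have "s \<le> \<theta>" by simp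
  then have "g s \<ge> g \<theta>"
  proof (rule DERIV_nonpos_imp_decreasing_open)
    show "\<exists>y. (g has_real_derivative y) (at x) \<and> y \<le> 0" if "s < x" "x < \<theta>" for x
      using deriv[of x] d_nonneg[of x] that assms(1,2)
      by (intro exI[of _ "(x - \<theta>) * d x"]) (auto intro: mult_nonpos_nonneg)
    show "continuous_on {s..\<theta>} g" using assms by (auto intro: continuous_on_subset)
  qed
  then show ?thesis using assms by simp
qed

text \<open>Divided by \<open>\<delta>\<close>, the left side is a difference quotient at 0 of
  \<open>y * exp (\<delta> * y)\<close> as a function of \<open>\<delta>\<close>, and the bound
  becomes free of \<open>\<delta>\<close>: a dominating function for the second moment. One half of
  \<open>\<rho>\<close> covers \<open>\<delta>\<close>, the other half absorbs
  \<open>y\<^sup>2\<close>.\<close>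

lemma square_mult_exp_bound:
  fixes y \<delta> \<rho> :: real
  assumes "0 < \<rho>" "0 \<le> \<delta>" "\<delta> \<le> \<rho> / 2" "\<rho> \<le> \<delta>0" "\<rho> \<le> \<delta>1"
  shows "\<bar>y * (exp (\<delta> * y) - 1)\<bar> \<le> \<delta> * (8 / \<rho>\<^sup>2 * (exp (\<delta>0 * y) + exp (- \<delta>1 * y)))"
proof -
  have "\<bar>exp (\<delta> * y) - 1\<bar> \<le> \<delta> * \<bar>y\<bar> * exp (\<delta> * \<bar>y\<bar>)"
  proof (cases "0 \<le> y")
    case True
    have "1 - \<delta> * y \<le> exp (- (\<delta> * y))" using exp_ge_add_one_self[of "- (\<delta> * y)"] by simp
    then have "exp (\<delta> * y) * (1 - \<delta> * y) \<le> exp (\<delta> * y) * exp (- (\<delta> * y))"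
      by (intro mult_left_mono) auto
    then have "exp (\<delta> * y) * (1 - \<delta> * y) \<le> 1" by (simp add: mult_exp_exp)
    then show ?thesis using True assms by (simp add: algebra_simps)
  next
    case False
    then have "\<delta> * y \<le> 0" using assms by (simp add: mult_nonneg_nonpos)
    then have "\<bar>exp (\<delta> * y) - 1\<bar> = 1 - exp (\<delta> * y)" by simp
    also have "\<dots> \<le> - (\<delta> * y)" using exp_ge_add_one_self[of "\<delta> * y"] by linarith
    also have "\<dots> = \<delta> * \<bar>y\<bar> * 1" using False by simp
    also have "\<dots> \<le> \<delta> * \<bar>y\<bar> * exp (\<delta> * \<bar>y\<bar>)"
      using assms by (intro mult_left_mono) auto
    finally show ?thesis .
  qed
  also have "\<dots> \<le> \<delta> * \<bar>y\<bar> * exp (\<rho> / 2 * \<bar>y\<bar>)"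
    using assms mult_right_mono[OF assms(3), of "\<bar>y\<bar>"] by (intro mult_left_mono) auto
  finally have "\<bar>y * (exp (\<delta> * y) - 1)\<bar> \<le> \<bar>y\<bar> * (\<delta> * \<bar>y\<bar> * exp (\<rho> / 2 * \<bar>y\<bar>))"
    unfolding abs_mult by (intro mult_left_mono) auto
  also have "\<dots> = \<delta> * (\<bar>y\<bar>\<^sup>2 * exp (\<rho> / 2 * \<bar>y\<bar>))" by (simp add: power2_eq_square)
  also have "\<dots> \<le> \<delta> * (8 / \<rho>\<^sup>2 * exp (\<rho> / 2 * \<bar>y\<bar>) * exp (\<rho> / 2 * \<bar>y\<bar>))"
  proof -
    \<comment> \<open>The quadratic Taylor term of \<open>exp\<close>; solving for the square of
      \<open>y\<close> gives the factor \<open>8 / \<rho>\<^sup>2\<close>.\<close>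
    have "(\<rho> / 2 * \<bar>y\<bar>)\<^sup>2 / 2 \<le> exp (\<rho> / 2 * \<bar>y\<bar>)"
    proof -
      have "0 \<le> \<rho> / 2 * \<bar>y\<bar>" using assms by simp
      then show ?thesis using exp_lower_Taylor_quadratic[of "\<rho> / 2 * \<bar>y\<bar>"] by linarith
    qed
    then have "\<bar>y\<bar>\<^sup>2 \<le> 8 / \<rho>\<^sup>2 * exp (\<rho> / 2 * \<bar>y\<bar>)"
      using assms by (simp add: field_simps power2_eq_square)
    then show ?thesis using assms by (intro mult_left_mono mult_right_mono) auto
  qed
  also have "\<dots> = \<delta> * (8 / \<rho>\<^sup>2 * exp (\<rho> * \<bar>y\<bar>))"
    by (simp add: mult.assoc mult_exp_exp)
  also have "\<dots> \<le> \<delta> * (8 / \<rho>\<^sup>2 * (exp (\<delta>0 * y) + exp (- \<delta>1 * y)))"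
  proof -
    have "exp (\<rho> * \<bar>y\<bar>) \<le> exp (\<delta>0 * y) + exp (- \<delta>1 * y)"
    proof (cases "0 \<le> y")
      case True
      then have "exp (\<rho> * \<bar>y\<bar>) \<le> exp (\<delta>0 * y)" using assms by (simp add: mult_right_mono)
      then show ?thesis by (meson add_increasing2 exp_ge_zero)
    next
      case False
      then have "exp (\<rho> * \<bar>y\<bar>) \<le> exp (- \<delta>1 * y)" using assms by (simp add: mult_right_mono_neg)
      then show ?thesis by (meson add_increasing exp_ge_zero)
    qed
    then show ?thesis using assms by (intro mult_left_mono) auto
  qed
  finally show ?thesis .
qed

section \<open>Fisher information and the quadratic size of the divergence\<close>

text \<open>A compact convex set of reals is written as \<open>{lo..hi}\<close>, which may be a
  single point. Derivatives at the ends are one-sided, so differential identities are stated in the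
  interior.\<close>

locale regular_exp_family = exp_family +
  fixes lo hi \<kappa> :: real and B' C' :: "real \<Rightarrow> real"
  assumes \<Theta>_eq: "\<Theta> = {lo..hi}"
    and C_mono: "mono_on \<Theta> C"
    and B_deriv_within: "\<And>t. t \<in> \<Theta> \<Longrightarrow> (B has_real_derivative B' t) (at t within \<Theta>)"
    and C_deriv_within: "\<And>t. t \<in> \<Theta> \<Longrightarrow> (C has_real_derivative C' t) (at t within \<Theta>)"
    and \<kappa>_ge_1: "1 \<le> \<kappa>"
    and fisher: "fisher_regular \<kappa> P q \<Theta>"
begin

lemma B_deriv: "lo < t \<Longrightarrow> t < hi \<Longrightarrow> (B has_real_derivative B' t) (at t)"
  using B_deriv_within[of t] by (simp add: \<Theta>_eq at_within_Icc_at)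

lemma C_deriv: "lo < t \<Longrightarrow> t < hi \<Longrightarrow> (C has_real_derivative C' t) (at t)"
  using C_deriv_within[of t] by (simp add: \<Theta>_eq at_within_Icc_at)

lemma continuous_on_B: "continuous_on \<Theta> B"
  using B_deriv_within by (meson DERIV_continuous_on)

lemma continuous_on_C: "continuous_on \<Theta> C"
  using C_deriv_within by (meson DERIV_continuous_on)

lemma C_strict_mono: "s \<in> \<Theta> \<Longrightarrow> t \<in> \<Theta> \<Longrightarrow> s < t \<Longrightarrow> C s < C t"
  using mono_onD[OF C_mono, of s t] inj_onD[OF inj_on_C, of s t] by fastforce

text \<open>The divergence \<open>K(\<theta>,t)\<close> is minimal at \<open>t = \<theta>\<close>.\<close>

lemma B'_eq:
  assumes "lo < \<theta>" "\<theta> < hi"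
  shows "B' \<theta> = \<theta> * C' \<theta>"
proof -
  have \<theta>: "\<theta> \<in> \<Theta>" using assms by (simp add: \<Theta>_eq)
  \<comment> \<open>Up to a constant this function is the divergence
    \<open>K(\<theta>,t)\<close>.\<close>
  have "((\<lambda>t. B t - \<theta> * C t) has_real_derivative B' \<theta> - \<theta> * C' \<theta>) (at \<theta>)"
    by (intro derivative_intros DERIV_cmult B_deriv C_deriv assms)
  moreover have "0 < min (\<theta> - lo) (hi - \<theta>)" using assms by simp
  moreover have "B \<theta> - \<theta> * C \<theta> \<le> B t - \<theta> * C t" if "\<bar>\<theta> - t\<bar> < min (\<theta> - lo) (hi - \<theta>)" for t
  proof -
    have t: "t \<in> \<Theta>" using that by (auto simp: \<Theta>_eq)
    show ?thesis using kullback_nonneg[OF \<theta> t] by (simp add: kullback_eq \<theta> t algebra_simps)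
  qed
  ultimately have "B' \<theta> - \<theta> * C' \<theta> = 0"
    by (intro DERIV_local_min[where d = "min (\<theta> - lo) (hi - \<theta>)"]) auto
  then show ?thesis by simp
qed

text \<open>By \<open>B'_eq\<close> the score is \<open>C' \<theta> * (y - \<theta>)\<close>
  wherever \<open>p y\<close> is positive.\<close>

lemma fisher_info_eq_square:
  assumes "lo < \<theta>" "\<theta> < hi"
  shows "fisher_info P q \<Theta> \<theta> = (C' \<theta>)\<^sup>2 * (\<integral>y. (y - \<theta>)\<^sup>2 \<partial>family_law P q \<theta>)"
proof -
  have \<theta>: "\<theta> \<in> \<Theta>" using assms by (simp add: \<Theta>_eq)
  have score: "vector_derivative (\<lambda>t. ln (q y t)) (at \<theta> within \<Theta>) = C' \<theta> * (y - \<theta>)"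
    if "0 < p y" for y
  proof -
    have "((\<lambda>t. ln (p y) + (y * C t - B t)) has_real_derivative y * C' \<theta> - B' \<theta>) (at \<theta>)"
      using assms by (auto intro!: derivative_eq_intros B_deriv C_deriv)
    then have "((\<lambda>t. ln (q y t)) has_real_derivative y * C' \<theta> - B' \<theta>) (at \<theta>)"
    proof (rule DERIV_cong_ev[THEN iffD1, rotated -1])
      have "eventually (\<lambda>t. t \<in> {lo<..<hi}) (nhds \<theta>)"
        using assms by (intro eventually_nhds_in_open) auto
      then show "eventually (\<lambda>t. ln (p y) + (y * C t - B t) = ln (q y t)) (nhds \<theta>)"
        by eventually_elim (use that in \<open>simp add: q_eq \<Theta>_eq ln_mult\<close>)
    qed auto
    then have "((\<lambda>t. ln (q y t)) has_vector_derivative C' \<theta> * (y - \<theta>)) (at \<theta>)"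
      by (simp add: has_real_derivative_iff_has_vector_derivative B'_eq[OF assms] algebra_simps)
    then show ?thesis
      using assms by (simp add: \<Theta>_eq at_within_Icc_at vector_derivative_at)
  qed
  have "fisher_info P q \<Theta> \<theta> = (\<integral>y. (C' \<theta>)\<^sup>2 * (y - \<theta>)\<^sup>2 \<partial>family_law P q \<theta>)"
    unfolding fisher_info_def
  proof (rule integral_cong_AE)
    show ae: "AE y in family_law P q \<theta>. \<bar>vector_derivative (\<lambda>t. ln (q y t)) (at \<theta> within \<Theta>)\<bar>\<^sup>2
        = (C' \<theta>)\<^sup>2 * (y - \<theta>)\<^sup>2"
      using AE_p_pos[OF \<theta>] by eventually_elim (simp add: score power_mult_distrib)
    show "(\<lambda>y. \<bar>vector_derivative (\<lambda>t. ln (q y t)) (at \<theta> within \<Theta>)\<bar>\<^sup>2)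
        \<in> borel_measurable (family_law P q \<theta>)"
    proof -
      \<comment> \<open>Measurability concerns every \<open>y\<close>, so the score must be known on
        the null set too: there \<open>ln 0 = 0\<close> makes it zero.\<close>
      have "vector_derivative (\<lambda>t. ln (q y t)) (at \<theta> within \<Theta>) = 0" if "\<not> 0 < p y" for y
      proof -
        have "p y = 0" using that p_nonneg[of y] by simp
        then have "((\<lambda>t. ln (q y t)) has_vector_derivative 0) (at \<theta> within \<Theta>)"
          by (intro has_vector_derivative_transform[OF \<theta> _ has_vector_derivative_const])
            (simp add: q_eq)
        then show ?thesis
          using assms by (simp add: \<Theta>_eq at_within_Icc_at vector_derivative_at)
      qed
      moreover have "0 < p y \<longleftrightarrow> 0 < q y \<theta>" for y
        by (simp add: q_eq \<theta> zero_less_mult_iff)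
      ultimately have "(\<lambda>y. \<bar>vector_derivative (\<lambda>t. ln (q y t)) (at \<theta> within \<Theta>)\<bar>\<^sup>2)
          = (\<lambda>y. if 0 < q y \<theta> then \<bar>C' \<theta> * (y - \<theta>)\<bar>\<^sup>2 else 0)"
        using score by (intro ext) auto
      moreover have "(\<lambda>y. q y \<theta>) \<in> borel_measurable borel"
        using q_measurable[OF \<theta>] by (simp add: measurable_cong_sets[OF sets_P refl])
      ultimately show ?thesis by simp
    qed
  qed measurable
  then show ?thesis by simp
qed

text \<open>A zero of \<open>C'\<close> would make the Fisher information vanish, and a negative
  value would contradict strict monotonicity of \<open>C\<close>.\<close>

lemma C'_pos:
  assumes "lo < \<theta>" "\<theta> < hi"
  shows "0 < C' \<theta>"
proof -
  have \<theta>: "\<theta> \<in> \<Theta>" using assms by (simp add: \<Theta>_eq)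
  have "C' \<theta> \<noteq> 0"
    using fisher fisher_info_eq_square[OF assms] \<theta> by (force simp: fisher_regular_def)
  moreover have "0 \<le> C' \<theta>"
  proof (rule ccontr)
    assume "\<not> 0 \<le> C' \<theta>"
    with DERIV_neg_dec_right[OF C_deriv[OF assms]] obtain d where
      d: "0 < d" "\<And>h. 0 < h \<Longrightarrow> h < d \<Longrightarrow> C (\<theta> + h) < C \<theta>" by auto
    define h where "h = min (d / 2) (hi - \<theta>)"
    have "0 < h" "h < d" "\<theta> + h \<in> \<Theta>" using d assms by (auto simp: h_def \<Theta>_eq)
    then show False using d(2)[of h] C_strict_mono[OF \<theta>, of "\<theta> + h"] by simp
  qed
  ultimately show ?thesis by simp
qed

text \<open>The identity \<open>E\<^sub>s Y = s\<close>, written as an expectation under \<open>P\<^sub>\<theta>\<close>, is differentiated at \<open>s = \<theta>\<close> from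
  the right; the difference quotients are dominated by exponential moments at the two endpoints of \<open>\<Theta>\<close>.\<close>

lemma second_moment:
  assumes "lo < \<theta>" "\<theta> < hi"
  shows "has_bochner_integral (family_law P q \<theta>) (\<lambda>y. y\<^sup>2) (1 / C' \<theta> + \<theta>\<^sup>2)"
proof -
  have \<theta>: "\<theta> \<in> \<Theta>" and ends: "lo \<in> \<Theta>" "hi \<in> \<Theta>" using assms by (auto simp: \<Theta>_eq)
  define \<delta>0 where "\<delta>0 = C hi - C \<theta>"
  define \<delta>1 where "\<delta>1 = C \<theta> - C lo"
  define \<rho> where "\<rho> = min \<delta>0 \<delta>1"
  have \<rho>: "0 < \<rho>" "\<rho> \<le> \<delta>0" "\<rho> \<le> \<delta>1"
    using C_strict_mono[OF \<theta> ends(2)] C_strict_mono[OF ends(1) \<theta>] assms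
    by (auto simp: \<rho>_def \<delta>0_def \<delta>1_def)
  \<comment> \<open>The summand 2 keeps \<open>s n\<close> strictly below \<open>hi\<close> for
    every \<open>n\<close>.\<close>
  define s where "s n = \<theta> + (hi - \<theta>) / real (n + 2)" for n
  define \<delta> where "\<delta> n = C (s n) - C \<theta>" for n
  have s: "\<theta> < s n" "s n < hi" "s n \<in> \<Theta>" for n
  proof -
    have "(hi - \<theta>) / real (n + 2) < (hi - \<theta>) / 1"
      using assms by (intro divide_strict_left_mono) auto
    then show *: "s n < hi" by (simp add: s_def)
    show **: "\<theta> < s n" using assms by (simp add: s_def)
    show "s n \<in> \<Theta>" using assms * ** by (simp add: \<Theta>_eq)
  qed
  have \<delta>_pos: "0 < \<delta> n" for n using C_strict_mono[OF \<theta> s(3)[of n] s(1)[of n]] by (simp add: \<delta>_def)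
  have "s \<longlonglongrightarrow> \<theta> + 0"
    unfolding s_def
    using LIMSEQ_ignore_initial_segment[OF lim_const_over_n[of "hi - \<theta>"], of 2]
    by (intro tendsto_add tendsto_const)
  then have s_lim: "s \<longlonglongrightarrow> \<theta>" by simp
  have s_at: "filterlim s (at \<theta>) sequentially"
    using s_lim s(1) by (auto simp: filterlim_at intro!: always_eventually less_imp_neq[symmetric])
  have "(\<lambda>n. C (s n)) \<longlonglongrightarrow> C \<theta>"
    using DERIV_isCont[OF C_deriv[OF assms]] s_lim by (rule isCont_tendsto_compose)
  then have \<delta>_lim: "\<delta> \<longlonglongrightarrow> 0" unfolding \<delta>_def by (auto intro: tendsto_eq_intros)
  then have "eventually (\<lambda>n. \<delta> n < \<rho> / 2) sequentially"
    using order_tendstoD(2)[OF \<delta>_lim, of "\<rho> / 2"] \<rho> by simp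
  then obtain n0 where n0: "\<And>n. n0 \<le> n \<Longrightarrow> \<delta> n < \<rho> / 2" by (auto simp: eventually_sequentially)

  \<comment> \<open>The difference quotients start at \<open>n0\<close>, from where on the increment
    is below \<open>\<rho> / 2\<close>, as the dominating bound demands.\<close>
  define \<psi> where "\<psi> n y = y * (exp (\<delta> (n + n0) * y) - 1) / \<delta> (n + n0)" for n y
  have \<psi>: "has_bochner_integral (family_law P q \<theta>) (\<psi> n)
      ((s (n + n0) * exp (B (s (n + n0)) - B \<theta>) - \<theta>) / \<delta> (n + n0))" for n
  proof -
    have "has_bochner_integral (family_law P q \<theta>) (\<lambda>y. y) \<theta>"
      using mean_integrable[OF \<theta>] mean_eq[OF \<theta>] by (simp add: has_bochner_integral_iff)
    from has_bochner_integral_diff[OF has_bochner_integral_mean_exp[OF \<theta> s(3)[of "n + n0"]] this]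
    have "has_bochner_integral (family_law P q \<theta>)
       (\<lambda>y. (y * exp (\<delta> (n + n0) * y) - y) / \<delta> (n + n0))
       ((s (n + n0) * exp (B (s (n + n0)) - B \<theta>) - \<theta>) / \<delta> (n + n0))"
      unfolding \<delta>_def by (rule has_bochner_integral_divide_zero)
    then show ?thesis by (simp add: \<psi>_def[abs_def] algebra_simps)
  qed
  define w where "w y = 8 / \<rho>\<^sup>2 * (exp (\<delta>0 * y) + exp (- \<delta>1 * y))" for y
  have w: "integrable (family_law P q \<theta>) w"
    using has_bochner_integral_exp[OF \<theta> ends(1)] has_bochner_integral_exp[OF \<theta> ends(2)]
    unfolding w_def \<delta>0_def \<delta>1_def by (auto simp: has_bochner_integral_iff)
  have lim: "(\<lambda>n. \<psi> n y) \<longlonglongrightarrow> y\<^sup>2" for y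
  proof -
    have "((\<lambda>h. exp (h * y)) has_real_derivative y) (at 0)"
      by (auto intro!: derivative_eq_intros)
    then have "((\<lambda>h. (exp (h * y) - 1) / h) \<longlongrightarrow> y) (at 0)"
      by (simp add: DERIV_def)
    moreover have "filterlim \<delta> (at 0) sequentially"
      using \<delta>_lim \<delta>_pos by (auto simp: filterlim_at intro!: always_eventually less_imp_neq[symmetric])
    ultimately have "(\<lambda>n. (exp (\<delta> n * y) - 1) / \<delta> n) \<longlonglongrightarrow> y"
      by (rule filterlim_compose)
    then have "(\<lambda>n. y * ((exp (\<delta> (n + n0) * y) - 1) / \<delta> (n + n0))) \<longlonglongrightarrow> y * y"
      by (intro tendsto_mult tendsto_const LIMSEQ_ignore_initial_segment)
    then show ?thesis by (simp add: \<psi>_def power2_eq_square)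
  qed
  have bound: "norm (\<psi> n y) \<le> w y" for n y
    using square_mult_exp_bound[OF \<rho>(1) _ _ \<rho>(2,3), of "\<delta> (n + n0)" y] n0[of "n + n0"] \<delta>_pos[of "n + n0"]
    by (simp add: \<psi>_def w_def field_simps)
  have meas: "\<psi> n \<in> borel_measurable (family_law P q \<theta>)" for n
    using \<psi> by (auto simp: has_bochner_integral_iff)
  have meas2: "(\<lambda>y. y\<^sup>2) \<in> borel_measurable (family_law P q \<theta>)" by measurable
  note dct = meas2 meas w AE_I2[OF lim] AE_I2[OF bound]
  have int: "integrable (family_law P q \<theta>) (\<lambda>y. y\<^sup>2)"
    by (rule integrable_dominated_convergence[OF dct])
  have "(\<lambda>n. integral\<^sup>L (family_law P q \<theta>) (\<psi> n)) \<longlonglongrightarrow> (\<integral>y. y\<^sup>2 \<partial>family_law P q \<theta>)"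
    by (rule integral_dominated_convergence[OF dct])
  then have "(\<lambda>n. (s (n + n0) * exp (B (s (n + n0)) - B \<theta>) - \<theta>) / \<delta> (n + n0))
      \<longlonglongrightarrow> (\<integral>y. y\<^sup>2 \<partial>family_law P q \<theta>)"
    using \<psi> by (simp add: has_bochner_integral_iff)
  \<comment> \<open>The numerator and the increment of \<open>C\<close> are both divided by
    \<open>s n - \<theta>\<close>, which gives a quotient of two derivatives at
    \<open>\<theta>\<close>.\<close>
  moreover have "(\<lambda>n. (s n * exp (B (s n) - B \<theta>) - \<theta>) / \<delta> n) \<longlonglongrightarrow> (1 + \<theta> * B' \<theta>) / C' \<theta>"
  proof -
    have "((\<lambda>t. t * exp (B t - B \<theta>)) has_real_derivative 1 + \<theta> * B' \<theta>) (at \<theta>)"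
      using assms by (auto intro!: derivative_eq_intros B_deriv)
    then have "((\<lambda>t. (t * exp (B t - B \<theta>) - \<theta>) / (t - \<theta>)) \<longlongrightarrow> 1 + \<theta> * B' \<theta>) (at \<theta>)"
      by (simp add: has_field_derivative_iff)
    then have num: "(\<lambda>n. (s n * exp (B (s n) - B \<theta>) - \<theta>) / (s n - \<theta>)) \<longlonglongrightarrow> 1 + \<theta> * B' \<theta>"
      using s_at by (rule filterlim_compose)
    have "((\<lambda>t. (C t - C \<theta>) / (t - \<theta>)) \<longlongrightarrow> C' \<theta>) (at \<theta>)"
      using C_deriv[OF assms] by (simp add: has_field_derivative_iff)
    then have den: "(\<lambda>n. \<delta> n / (s n - \<theta>)) \<longlonglongrightarrow> C' \<theta>"
      unfolding \<delta>_def using s_at by (rule filterlim_compose)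
    have "s n - \<theta> \<noteq> 0" for n using s(1)[of n] by simp
    with tendsto_divide[OF num den] C'_pos[OF assms] show ?thesis by simp
  qed
  then have "(\<lambda>n. (s (n + n0) * exp (B (s (n + n0)) - B \<theta>) - \<theta>) / \<delta> (n + n0))
      \<longlonglongrightarrow> (1 + \<theta> * B' \<theta>) / C' \<theta>"
    by (rule LIMSEQ_ignore_initial_segment)
  ultimately have "(\<integral>y. y\<^sup>2 \<partial>family_law P q \<theta>) = (1 + \<theta> * B' \<theta>) / C' \<theta>"
    by (rule LIMSEQ_unique)
  also have "\<dots> = 1 / C' \<theta> + \<theta>\<^sup>2"
    using C'_pos[OF assms] by (simp add: B'_eq[OF assms] field_simps power2_eq_square)
  finally show ?thesis using int by (simp add: has_bochner_integral_iff)
qed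

text \<open>The second moment makes the variance \<open>1 / C' \<theta>\<close>. Hence the ratio
  condition on the information is one on \<open>C'\<close>.\<close>

lemma fisher_info_eq:
  assumes "lo < \<theta>" "\<theta> < hi"
  shows "fisher_info P q \<Theta> \<theta> = C' \<theta>"
proof -
  have \<theta>: "\<theta> \<in> \<Theta>" using assms by (simp add: \<Theta>_eq)
  interpret prob_space "family_law P q \<theta>" by (rule prob_space_family_law[OF \<theta>])
  note m2 = second_moment[OF assms, unfolded has_bochner_integral_iff]
  have "(\<integral>y. (y - \<theta>)\<^sup>2 \<partial>family_law P q \<theta>) = (\<integral>y. y\<^sup>2 - 2 * \<theta> * y + \<theta>\<^sup>2 \<partial>family_law P q \<theta>)"
    by (simp add: power2_diff algebra_simps)
  also have "\<dots> = 1 / C' \<theta>"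
    using m2 mean_integrable[OF \<theta>] mean_eq[OF \<theta>]
    by (simp add: prob_space power2_eq_square)
  finally show ?thesis
    using C'_pos[OF assms] by (simp add: fisher_info_eq_square[OF assms] power2_eq_square)
qed

text \<open>In the interior the derivative of \<open>K(\<theta>,s)\<close> in \<open>s\<close> is
  \<open>(s - \<theta>) * C' s\<close>, and \<open>C'\<close> lies between \<open>m\<close> and
  \<open>\<kappa> ^ 4 * m\<close>. The constant \<open>c\<close> depends on the family, the quotient
  \<open>\<kappa> ^ 4\<close> of the two bounds does not.\<close>

lemma kullback_quadratic:
  "\<exists>c>0. \<forall>\<theta>\<in>\<Theta>. \<forall>s\<in>\<Theta>.
     c * (\<theta> - s)\<^sup>2 \<le> kullback P q \<theta> s \<and> kullback P q \<theta> s \<le> \<kappa> ^ 4 * c * (\<theta> - s)\<^sup>2"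
proof (cases "lo < hi")
  \<comment> \<open>The interval has at most one point, so every \<open>c\<close> works.\<close>
  case False
  have "\<theta> - s = 0 \<and> kullback P q \<theta> s = 0" if "\<theta> \<in> \<Theta>" "s \<in> \<Theta>" for \<theta> s
  proof -
    have "\<theta> = s" using False that by (auto simp: \<Theta>_eq)
    then show ?thesis using that by (simp add: kullback_eq)
  qed
  then show ?thesis by (intro exI[of _ 1]) simp
next
  case True
  define t0 where "t0 = (lo + hi) / 2"
  have t0: "lo < t0" "t0 < hi" using True by (auto simp: t0_def)
  \<comment> \<open>\<open>C'\<close> at the midpoint serves as reference. Interior values differ
    from it by at most the factor \<open>\<kappa>\<^sup>2\<close> in either direction.\<close>
  define m where "m = C' t0 / \<kappa>\<^sup>2"
  have ratio: "C' s \<le> \<kappa>\<^sup>2 * C' t" if "lo < s" "s < hi" "lo < t" "t < hi" for s t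
  proof -
    have "sqrt \<bar>C' s / C' t\<bar> \<le> \<kappa>"
      using fisher that unfolding fisher_regular_def
      by (metis \<Theta>_eq atLeastAtMost_iff fisher_info_eq less_imp_le)
    then have "C' s / C' t \<le> \<kappa>\<^sup>2"
      using C'_pos[of s] C'_pos[of t] that sqrt_le_D by fastforce
    then show ?thesis using C'_pos[of t] that by (simp add: pos_divide_le_eq)
  qed
  have m_pos: "0 < m" using C'_pos[OF t0] \<kappa>_ge_1 by (simp add: m_def)
  have m_le: "m \<le> C' t" and le_m: "C' t \<le> \<kappa> ^ 4 * m" if "lo < t" "t < hi" for t
  proof -
    show "m \<le> C' t"
      using ratio[OF t0 that] \<kappa>_ge_1 by (simp add: m_def pos_divide_le_eq mult.commute)
    have "\<kappa> ^ 4 * m = \<kappa>\<^sup>2 * C' t0"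
      using \<kappa>_ge_1 by (simp add: m_def power2_eq_square power4_eq_xxxx)
    then show "C' t \<le> \<kappa> ^ 4 * m" using ratio[OF that t0] by simp
  qed
  have lower: "m / 2 * (\<theta> - s)\<^sup>2 \<le> kullback P q \<theta> s" if "\<theta> \<in> \<Theta>" "s \<in> \<Theta>" for \<theta> s
  proof -
    have "0 \<le> \<theta> * (C \<theta> - C s) - (B \<theta> - B s) - m / 2 * (s - \<theta>)\<^sup>2"
    proof (rule nonneg_if_deriv_sign[where lo = lo and hi = hi and \<theta> = \<theta>
          and g = "\<lambda>s. \<theta> * (C \<theta> - C s) - (B \<theta> - B s) - m / 2 * (s - \<theta>)\<^sup>2" and d = "\<lambda>x. C' x - m"])
      show "continuous_on {lo..hi} (\<lambda>s. \<theta> * (C \<theta> - C s) - (B \<theta> - B s) - m / 2 * (s - \<theta>)\<^sup>2)"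
        using continuous_on_B continuous_on_C by (intro continuous_intros) (simp_all add: \<Theta>_eq)
      show "((\<lambda>s. \<theta> * (C \<theta> - C s) - (B \<theta> - B s) - m / 2 * (s - \<theta>)\<^sup>2) has_real_derivative
          (x - \<theta>) * (C' x - m)) (at x)" if "lo < x" "x < hi" for x
        using that by (auto intro!: derivative_eq_intros B_deriv C_deriv simp: B'_eq field_simps)
    qed (use that m_le in \<open>auto simp: \<Theta>_eq\<close>)
    then show ?thesis by (simp add: kullback_eq that power2_commute)
  qed
  moreover have upper: "kullback P q \<theta> s \<le> \<kappa> ^ 4 * (m / 2) * (\<theta> - s)\<^sup>2" if "\<theta> \<in> \<Theta>" "s \<in> \<Theta>" for \<theta> s
  proof -
    have "0 \<le> \<kappa> ^ 4 * m / 2 * (s - \<theta>)\<^sup>2 - (\<theta> * (C \<theta> - C s) - (B \<theta> - B s))"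
    proof (rule nonneg_if_deriv_sign[where lo = lo and hi = hi and \<theta> = \<theta>
          and g = "\<lambda>s. \<kappa> ^ 4 * m / 2 * (s - \<theta>)\<^sup>2 - (\<theta> * (C \<theta> - C s) - (B \<theta> - B s))" and d = "\<lambda>x. \<kappa> ^ 4 * m - C' x"])
      show "continuous_on {lo..hi}
          (\<lambda>s. \<kappa> ^ 4 * m / 2 * (s - \<theta>)\<^sup>2 - (\<theta> * (C \<theta> - C s) - (B \<theta> - B s)))"
        using continuous_on_B continuous_on_C by (intro continuous_intros) (simp_all add: \<Theta>_eq)
      show "((\<lambda>s. \<kappa> ^ 4 * m / 2 * (s - \<theta>)\<^sup>2 - (\<theta> * (C \<theta> - C s) - (B \<theta> - B s))) has_real_derivative
          (x - \<theta>) * (\<kappa> ^ 4 * m - C' x)) (at x)" if "lo < x" "x < hi" for x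
        using that by (auto intro!: derivative_eq_intros B_deriv C_deriv simp: B'_eq field_simps)
    qed (use that le_m in \<open>auto simp: \<Theta>_eq\<close>)
    then show ?thesis by (simp add: kullback_eq that power2_commute)
  qed
  ultimately show ?thesis using m_pos by (intro exI[of _ "m / 2"]) auto
qed

end

section \<open>Deviations of the weak estimates\<close>

context exp_family
begin

text \<open>Jensen's inequality for the power \<open>a\<close>, concave as
  \<open>0 \<le> a \<le> 1\<close>. In elementary form: convexity of \<open>exp\<close> bounds this
  power of the likelihood ratio by an affine function of the ratio.\<close>

lemma nn_integral_exp_weighted_le:
  assumes "\<theta> \<in> \<Theta>" "s \<in> \<Theta>" "0 \<le> a" "a \<le> 1"
  shows "(\<integral>\<^sup>+y. ennreal (exp (a * ((C s - C \<theta>) * y))) \<partial>family_law P q \<theta>) \<le> ennreal (exp (a * (B s - B \<theta>)))"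
proof -
  interpret prob_space "family_law P q \<theta>" by (rule prob_space_family_law[OF assms(1)])
  define D where "D = B s - B \<theta>"
  have le: "exp (a * x) \<le> exp (a * D) * (1 - a) + exp (a * D) * a * exp (- D) * exp x" for x
  proof -
    have "exp (a * (x - D)) \<le> (1 - a) * exp 0 + a * exp (x - D)"
      using convex_onD[OF exp_convex, of a 0 "x - D"] assms by simp
    then have "exp (a * D) * exp (a * (x - D)) \<le> exp (a * D) * ((1 - a) + a * exp (x - D))"
      by (intro mult_left_mono) auto
    then show ?thesis by (simp add: mult_exp_exp algebra_simps)
  qed
  have "(\<integral>\<^sup>+y. ennreal (exp (a * ((C s - C \<theta>) * y))) \<partial>family_law P q \<theta>)
      \<le> (\<integral>\<^sup>+y. ennreal (exp (a * D) * (1 - a)) +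
            ennreal (exp (a * D) * a * exp (- D)) * ennreal (exp ((C s - C \<theta>) * y)) \<partial>family_law P q \<theta>)"
    using assms le
    by (intro nn_integral_mono) (simp add: ennreal_mult[symmetric] ennreal_plus[symmetric] del: ennreal_plus)
  also have "\<dots> = ennreal (exp (a * D) * (1 - a)) + ennreal (exp (a * D) * a * exp (- D)) * ennreal (exp D)"
    using assms
    by (subst nn_integral_add, simp_all add: nn_integral_cmult nn_integral_exp emeasure_space_1 D_def[symmetric])
  also have "\<dots> = ennreal (exp (a * D) * (1 - a) + exp (a * D) * a * (exp (- D) * exp D))"
    using assms by (simp add: ennreal_mult[symmetric] ennreal_plus[symmetric] mult.assoc del: ennreal_plus)
  also have "exp (a * D) * (1 - a) + exp (a * D) * a * (exp (- D) * exp D) = exp (a * D)"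
    by (simp add: exp_minus field_simps)
  finally show ?thesis by (simp add: D_def)
qed

text \<open>Independence splits the integral into one factor per observation.\<close>

lemma nn_integral_exp_weighted_sum_le:
  fixes M :: "'i \<Rightarrow> 'a measure" and X :: "'a \<Rightarrow> real"
  assumes "\<theta> \<in> \<Theta>" "s \<in> \<Theta>" "finite I"
    and prob: "\<And>i. i \<in> I \<Longrightarrow> prob_space (M i)"
    and X: "\<And>i. i \<in> I \<Longrightarrow> X \<in> borel_measurable (M i)"
    and law: "\<And>i. i \<in> I \<Longrightarrow> distr (M i) borel X = family_law P q \<theta>"
    and a: "\<And>i. i \<in> I \<Longrightarrow> 0 \<le> a i" "\<And>i. i \<in> I \<Longrightarrow> a i \<le> 1"
  shows "(\<integral>\<^sup>+\<omega>. ennreal (exp ((C s - C \<theta>) * (\<Sum>i\<in>I. a i * X (\<omega> i)))) \<partial>Pi\<^sub>M I M)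
           \<le> ennreal (exp ((\<Sum>i\<in>I. a i) * (B s - B \<theta>)))"
proof -
  \<comment> \<open>The product locale wants a measure at every index; outside \<open>I\<close> a
    point mass is inserted.\<close>
  define M' where "M' i = (if i \<in> I then M i else return (count_space UNIV) undefined)" for i
  have M'_prob: "prob_space (M' i)" for i
    using prob by (simp add: M'_def prob_space_return)
  interpret product_sigma_finite M'
    by (intro product_sigma_finite.intro prob_space_imp_sigma_finite M'_prob)
  have PiM_eq: "Pi\<^sub>M I M = Pi\<^sub>M I M'" by (intro PiM_cong) (auto simp: M'_def)
  define g where "g i x = ennreal (exp (a i * ((C s - C \<theta>) * X x)))" for i x
  have "(\<integral>\<^sup>+\<omega>. ennreal (exp ((C s - C \<theta>) * (\<Sum>i\<in>I. a i * X (\<omega> i)))) \<partial>Pi\<^sub>M I M)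
      = (\<integral>\<^sup>+\<omega>. (\<Prod>i\<in>I. g i (\<omega> i)) \<partial>Pi\<^sub>M I M')"
    unfolding PiM_eq g_def
    by (intro nn_integral_cong)
      (simp add: prod_ennreal exp_sum[OF \<open>finite I\<close>, symmetric] sum_distrib_left mult_ac)
  also have "\<dots> = (\<Prod>i\<in>I. integral\<^sup>N (M' i) (g i))"
  proof (rule product_nn_integral_prod[OF \<open>finite I\<close>])
    fix i assume "i \<in> I"
    then have [measurable]: "X \<in> borel_measurable (M' i)" using X by (simp add: M'_def)
    show "g i \<in> borel_measurable (M' i)" unfolding g_def by measurable
  qed
  also have "\<dots> \<le> (\<Prod>i\<in>I. ennreal (exp (a i * (B s - B \<theta>))))"
  proof (rule prod_mono_ennreal)
    fix i assume i: "i \<in> I"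
    have "integral\<^sup>N (M' i) (g i)
        = (\<integral>\<^sup>+y. ennreal (exp (a i * ((C s - C \<theta>) * y))) \<partial>distr (M i) borel X)"
      using X[OF i] i by (subst nn_integral_distr) (simp_all add: g_def[abs_def] M'_def)
    then show "integral\<^sup>N (M' i) (g i) \<le> ennreal (exp (a i * (B s - B \<theta>)))"
      using nn_integral_exp_weighted_le[OF assms(1,2) a[OF i]] by (simp add: law[OF i])
  qed
  also have "\<dots> = ennreal (exp ((\<Sum>i\<in>I. a i) * (B s - B \<theta>)))"
    by (simp add: prod_ennreal exp_sum[OF \<open>finite I\<close>, symmetric] sum_distrib_right)
  finally show ?thesis .
qed

text \<open>Exponential Markov inequality with the tilt from \<open>\<theta>\<close> to
  \<open>s\<close>. The sign of \<open>C s - C \<theta>\<close> selects the upper or the lower tail,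
  and the exponent left over is the divergence \<open>K(s,\<theta>)\<close> times the sum of the
  weights.\<close>

lemma chernoff_bound:
  fixes M :: "'i \<Rightarrow> 'a measure" and X :: "'a \<Rightarrow> real"
  assumes "\<theta> \<in> \<Theta>" "s \<in> \<Theta>" "finite I"
    and prob: "\<And>i. i \<in> I \<Longrightarrow> prob_space (M i)"
    and X: "\<And>i. i \<in> I \<Longrightarrow> X \<in> borel_measurable (M i)"
    and law: "\<And>i. i \<in> I \<Longrightarrow> distr (M i) borel X = family_law P q \<theta>"
    and a: "\<And>i. i \<in> I \<Longrightarrow> 0 \<le> a i" "\<And>i. i \<in> I \<Longrightarrow> a i \<le> 1"
  shows "emeasure (Pi\<^sub>M I M)
      {\<omega>\<in>space (Pi\<^sub>M I M). 0 \<le> (C s - C \<theta>) * ((\<Sum>i\<in>I. a i * X (\<omega> i)) - (\<Sum>i\<in>I. a i) * s)}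
    \<le> ennreal (exp (- ((\<Sum>i\<in>I. a i) * kullback P q s \<theta>)))"
proof -
  define S where "S \<omega> = (\<Sum>i\<in>I. a i * X (\<omega> i))" for \<omega>
  define N where "N = (\<Sum>i\<in>I. a i)"
  define \<delta> where "\<delta> = C s - C \<theta>"
  have S_meas [measurable]: "S \<in> borel_measurable (Pi\<^sub>M I M)"
    unfolding S_def using X
    by (intro borel_measurable_sum borel_measurable_times borel_measurable_const)
      (auto intro: measurable_compose[OF measurable_component_singleton])
  have "emeasure (Pi\<^sub>M I M) {\<omega>\<in>space (Pi\<^sub>M I M). 0 \<le> \<delta> * (S \<omega> - N * s)}
      = (\<integral>\<^sup>+\<omega>. indicator {\<omega>\<in>space (Pi\<^sub>M I M). 0 \<le> \<delta> * (S \<omega> - N * s)} \<omega> \<partial>Pi\<^sub>M I M)"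
    by (rule nn_integral_indicator[symmetric]) measurable
  also have "\<dots> \<le> (\<integral>\<^sup>+\<omega>. ennreal (exp (- (\<delta> * N * s))) * ennreal (exp (\<delta> * S \<omega>)) \<partial>Pi\<^sub>M I M)"
    by (intro nn_integral_mono)
      (auto simp: indicator_def ennreal_mult[symmetric] mult_exp_exp algebra_simps)
  also have "\<dots> = ennreal (exp (- (\<delta> * N * s))) * (\<integral>\<^sup>+\<omega>. ennreal (exp (\<delta> * S \<omega>)) \<partial>Pi\<^sub>M I M)"
    by (intro nn_integral_cmult) measurable
  also have "\<dots> \<le> ennreal (exp (- (\<delta> * N * s))) * ennreal (exp (N * (B s - B \<theta>)))"
    unfolding S_def N_def \<delta>_def
    by (intro mult_left_mono nn_integral_exp_weighted_sum_le assms) auto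
  also have "\<dots> = ennreal (exp (- (N * kullback P q s \<theta>)))"
    using assms by (simp add: ennreal_mult[symmetric] mult_exp_exp kullback_eq \<delta>_def algebra_simps)
  finally show ?thesis unfolding S_def N_def \<delta>_def .
qed

end

section \<open>Exponential moments from exponential tails\<close>

text \<open>The first summand accounts for values up to 1, the second is a geometric series with
  ratio \<open>exp (- (1/2))\<close> over unit slices.\<close>

definition tail_moment :: real where
  "tail_moment = exp (1/2) + 2 * exp (1/2) / (1 - exp (- (1/2)))"

lemma tail_moment_pos: "0 < tail_moment"
  unfolding tail_moment_def by (intro add_pos_pos divide_pos_pos) auto

text \<open>On the slice \<open>m < X \<le> m + 1\<close> the integrand is at most
  \<open>exp ((m + 1) / 2)\<close>, against a probability of at most \<open>2 * exp (- m)\<close>;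
  the products form a geometric series.\<close>

lemma nn_integral_exp_half_le:
  fixes X :: "'a \<Rightarrow> real"
  assumes "prob_space M" and [measurable]: "X \<in> borel_measurable M"
    and tail: "\<And>z. 0 \<le> z \<Longrightarrow> emeasure M {\<omega>\<in>space M. z < X \<omega>} \<le> ennreal (2 * exp (- z))"
  shows "(\<integral>\<^sup>+\<omega>. ennreal (exp (X \<omega> / 2)) \<partial>M) \<le> ennreal tail_moment"
proof -
  interpret prob_space M by fact
  define A where "A m = {\<omega>\<in>space M. real m < X \<omega>}" for m :: nat
  have [measurable]: "A m \<in> sets M" for m unfolding A_def by measurable
  have "(\<integral>\<^sup>+\<omega>. ennreal (exp (X \<omega> / 2)) \<partial>M)
      \<le> (\<integral>\<^sup>+\<omega>. ennreal (exp (1/2)) + (\<Sum>m. ennreal (exp ((real m + 1) / 2)) * indicator (A m) \<omega>) \<partial>M)"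
  proof (rule nn_integral_mono)
    fix \<omega> assume \<omega>: "\<omega> \<in> space M"
    define f where "f m = ennreal (exp ((real m + 1) / 2)) * indicator (A m) \<omega>" for m
    have "ennreal (exp (X \<omega> / 2)) \<le> ennreal (exp (1/2)) + (\<Sum>m. f m)"
    proof (cases "X \<omega> \<le> 1")
      case True
      then have "ennreal (exp (X \<omega> / 2)) \<le> ennreal (exp (1/2))" by (simp add: ennreal_leI)
      then show ?thesis by (rule add_increasing2[rotated]) simp
    next
      case False
      \<comment> \<open>Ceiling minus one stays strictly below \<open>X \<omega>\<close> even when
        \<open>X \<omega>\<close> is an integer.\<close>
      define m where "m = nat (\<lceil>X \<omega>\<rceil> - 1)"
      have m: "real m < X \<omega>" "X \<omega> \<le> real m + 1"
        using False unfolding m_def by linarith+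
      have "ennreal (exp (X \<omega> / 2)) \<le> f m"
        using m \<omega> by (simp add: f_def A_def ennreal_leI)
      also have "\<dots> = sum f {m}" by simp
      also have "\<dots> \<le> (\<Sum>m. f m)" by (rule sum_le_suminf) auto
      finally show ?thesis by (rule add_increasing[rotated]) simp
    qed
    then show "ennreal (exp (X \<omega> / 2))
        \<le> ennreal (exp (1/2)) + (\<Sum>m. ennreal (exp ((real m + 1) / 2)) * indicator (A m) \<omega>)"
      by (simp add: f_def)
  qed
  also have "\<dots> = ennreal (exp (1/2)) + (\<Sum>m. ennreal (exp ((real m + 1) / 2)) * emeasure M (A m))"
    by (subst nn_integral_add, simp_all add: emeasure_space_1)
      (subst nn_integral_suminf, simp_all add: nn_integral_cmult)
  also have "\<dots> \<le> ennreal (exp (1/2)) + (\<Sum>m. ennreal (2 * exp (1/2) * exp (- (1/2)) ^ m))"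
  proof (intro add_left_mono suminf_le allI)
    fix m
    have "ennreal (exp ((real m + 1) / 2)) * emeasure M (A m)
        \<le> ennreal (exp ((real m + 1) / 2)) * ennreal (2 * exp (- real m))"
      unfolding A_def by (intro mult_left_mono tail) auto
    also have "\<dots> = ennreal (2 * exp (1/2) * exp (- (1/2)) ^ m)"
      by (simp add: ennreal_mult[symmetric] mult_exp_exp exp_of_nat_mult[symmetric] field_simps)
    finally show "ennreal (exp ((real m + 1) / 2)) * emeasure M (A m)
        \<le> ennreal (2 * exp (1/2) * exp (- (1/2)) ^ m)" .
  qed auto
  also have "(\<Sum>m. ennreal (2 * exp (1/2) * exp (- (1/2)) ^ m)) = ennreal (2 * exp (1/2) / (1 - exp (- (1/2::real))))"
    using sums_mult[OF geometric_sums[of "exp (- (1/2::real))"], of "2 * exp (1/2)"]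
    by (intro suminf_ennreal_eq) auto
  also have "ennreal (exp (1/2)) + \<dots> = ennreal tail_moment"
    unfolding tail_moment_def by (intro ennreal_plus[symmetric]) auto
  finally show ?thesis .
qed

section \<open>Form and exponential moments of the weak estimates\<close>

context regular_exp_family
begin

text \<open>If \<open>t\<close> maximises and \<open>s\<close> is another point of
  \<open>\<Theta>\<close>, the gain \<open>?F t - ?F s\<close> is
  \<open>(S - N * s) * (C t - C s)\<close> minus a positive divergence term. So
  \<open>S - N * s\<close> has the sign of \<open>t - s\<close>, and \<open>t\<close> is the point
  of \<open>\<Theta>\<close> nearest to the mean.\<close>

lemma local_mle_eq:
  fixes wk y :: "nat \<Rightarrow> real"
  assumes "lo \<le> hi" and y: "\<And>i. i \<in> {1..n} \<Longrightarrow> 0 < p (y i)"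
    and N: "0 < (\<Sum>i=1..n. wk i)"
  shows "local_mle q \<Theta> n wk y = max lo (min hi ((\<Sum>i=1..n. wk i * y i) / (\<Sum>i=1..n. wk i)))"
proof -
  define S where "S = (\<Sum>i=1..n. wk i * y i)"
  define N where "N = (\<Sum>i=1..n. wk i)"
  define t where "t = local_mle q \<Theta> n wk y"
  let ?L = "\<lambda>\<theta>. \<Sum>i=1..n. wk i * ln (q (y i) \<theta>)"
  let ?F = "\<lambda>\<theta>. (\<Sum>i=1..n. wk i * ln (p (y i))) + S * C \<theta> - N * B \<theta>"
  have L: "?L \<theta> = ?F \<theta>" if "\<theta> \<in> \<Theta>" for \<theta>
  proof -
    have "?L \<theta> = (\<Sum>i=1..n. wk i * ln (p (y i)) + wk i * y i * C \<theta> - wk i * B \<theta>)"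
    proof (rule sum.cong[OF refl])
      fix i assume "i \<in> {1..n}"
      from y[OF this] that
      show "wk i * ln (q (y i) \<theta>) = wk i * ln (p (y i)) + wk i * y i * C \<theta> - wk i * B \<theta>"
        by (simp add: q_eq ln_mult algebra_simps)
    qed
    then show ?thesis by (simp add: S_def N_def sum.distrib sum_subtractf sum_distrib_right)
  qed
  \<comment> \<open>A maximiser must be shown to exist before \<open>arg_max_on\<close>, which is
    defined by choice, is known to return one.\<close>
  have "continuous_on \<Theta> ?F"
    by (intro continuous_intros continuous_on_B continuous_on_C)
  moreover have "compact \<Theta>" "\<Theta> \<noteq> {}" using \<open>lo \<le> hi\<close> by (auto simp: \<Theta>_eq)
  ultimately have "\<exists>m\<in>\<Theta>. \<forall>\<theta>\<in>\<Theta>. ?F \<theta> \<le> ?F m"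
    by (intro continuous_attains_sup)
  then obtain m where m: "m \<in> \<Theta>" "\<And>\<theta>. \<theta> \<in> \<Theta> \<Longrightarrow> ?L \<theta> \<le> ?L m"
    by (auto simp only: L)
  have t: "t \<in> \<Theta> \<and> (\<forall>\<theta>\<in>\<Theta>. ?L \<theta> \<le> ?L t)"
    unfolding t_def local_mle_def arg_max_on_def
    by (rule arg_maxI[of _ m]) (use m in \<open>auto simp: not_less\<close>)
  obtain c where c: "0 < c" "\<And>\<theta> s. \<theta> \<in> \<Theta> \<Longrightarrow> s \<in> \<Theta> \<Longrightarrow> c * (\<theta> - s)\<^sup>2 \<le> kullback P q \<theta> s"
    using kullback_quadratic by blast
  have key: "0 < (S - N * s) * (C t - C s)" if s: "s \<in> \<Theta>" "s \<noteq> t" for s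
  proof -
    have "0 < c * (s - t)\<^sup>2" using c s by simp
    also have "\<dots> \<le> kullback P q s t" using c s t by blast
    finally have "0 < N * kullback P q s t" using N by (simp add: N_def)
    moreover have "?F s \<le> ?F t" using L[OF s(1)] L[of t] t s(1) by metis
    moreover have "?F t - ?F s = (S - N * s) * (C t - C s) - N * kullback P q s t"
      using s t by (simp add: kullback_eq algebra_simps)
    ultimately show ?thesis by linarith
  qed
  have N_pos: "0 < N" using N by (simp add: N_def)
  define x where "x = S / N"
  have above: "s < x" if "s \<in> \<Theta>" "s < t" for s
    using key[of s] C_strict_mono[of s t] that t N_pos
    by (auto simp: zero_less_mult_iff x_def pos_less_divide_eq pos_divide_less_eq mult.commute)
  have below: "x < s" if "s \<in> \<Theta>" "t < s" for s
    using key[of s] C_strict_mono[of t s] that t N_pos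
    by (auto simp: zero_less_mult_iff x_def pos_less_divide_eq pos_divide_less_eq mult.commute)
  define s where "s = max lo (min hi x)"
  have "s \<in> \<Theta>" using \<open>lo \<le> hi\<close> by (auto simp: s_def \<Theta>_eq)
  have "\<not> s < t"
  proof
    assume "s < t"
    then have "s < x" "s < hi" using above \<open>s \<in> \<Theta>\<close> t by (auto simp: \<Theta>_eq)
    then show False unfolding s_def by linarith
  qed
  moreover have "\<not> t < s"
  proof
    assume "t < s"
    then have "x < s" "lo < s" using below \<open>s \<in> \<Theta>\<close> t by (auto simp: \<Theta>_eq)
    then show False unfolding s_def by linarith
  qed
  ultimately have "t = s" by simp
  then show ?thesis by (simp add: t_def s_def x_def S_def N_def)
qed

text \<open>If the scaled squared error exceeds \<open>z\<close>, the estimate lies beyond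
  \<open>\<theta> + \<delta>\<close> or \<open>\<theta> - \<delta>\<close>, where
  \<open>c * N * \<delta>\<^sup>2 = z\<close>. The Chernoff bound at these two points and the
  quadratic lower bound on the divergence give the tail \<open>2 * exp (- z)\<close>.\<close>

lemma nn_integral_exp_mle_error_le:
  fixes M :: "'i \<Rightarrow> 'a measure" and X :: "'a \<Rightarrow> real"
  assumes "\<theta> \<in> \<Theta>" "finite I" "0 < c"
    and c: "\<And>s. s \<in> \<Theta> \<Longrightarrow> c * (s - \<theta>)\<^sup>2 \<le> kullback P q s \<theta>"
    and prob: "\<And>i. i \<in> I \<Longrightarrow> prob_space (M i)"
    and X: "\<And>i. i \<in> I \<Longrightarrow> X \<in> borel_measurable (M i)"
    and law: "\<And>i. i \<in> I \<Longrightarrow> distr (M i) borel X = family_law P q \<theta>"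
    and a: "\<And>i. i \<in> I \<Longrightarrow> 0 \<le> a i" "\<And>i. i \<in> I \<Longrightarrow> a i \<le> 1"
    and N: "N = (\<Sum>i\<in>I. a i)" "0 < N"
  shows "(\<integral>\<^sup>+\<omega>. ennreal (exp (c * N * (max lo (min hi ((\<Sum>i\<in>I. a i * X (\<omega> i)) / N)) - \<theta>)\<^sup>2 / 2)) \<partial>Pi\<^sub>M I M)
    \<le> ennreal tail_moment"
proof (rule nn_integral_exp_half_le)
  show "prob_space (Pi\<^sub>M I M)" by (rule prob_space_PiM) (rule prob)
  define S where "S \<omega> = (\<Sum>i\<in>I. a i * X (\<omega> i))" for \<omega>
  define t where "t \<omega> = max lo (min hi (S \<omega> / N))" for \<omega>
  have S_meas [measurable]: "S \<in> borel_measurable (Pi\<^sub>M I M)"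
    unfolding S_def using X
    by (intro borel_measurable_sum borel_measurable_times borel_measurable_const)
      (auto intro: measurable_compose[OF measurable_component_singleton])
  have [measurable]: "t \<in> borel_measurable (Pi\<^sub>M I M)" unfolding t_def by measurable
  show "(\<lambda>\<omega>. c * N * (max lo (min hi ((\<Sum>i\<in>I. a i * X (\<omega> i)) / N)) - \<theta>)\<^sup>2) \<in> borel_measurable (Pi\<^sub>M I M)"
    unfolding S_def[symmetric] t_def[symmetric] by measurable
  fix z :: real assume z: "0 \<le> z"
  define \<delta> where "\<delta> = sqrt (z / (c * N))"
  have \<delta>: "0 \<le> \<delta>" "c * N * \<delta>\<^sup>2 = z" using z N \<open>0 < c\<close> by (auto simp: \<delta>_def)
  \<comment> \<open>For \<open>s\<close> outside \<open>\<Theta>\<close> there is no law to tilt to.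
    The event is set empty, since the truncated estimate cannot pass such a point.\<close>
  define E where "E s = (if s \<in> \<Theta> then {\<omega>\<in>space (Pi\<^sub>M I M). 0 \<le> (C s - C \<theta>) * (S \<omega> - N * s)} else {})" for s
  have [measurable]: "E s \<in> sets (Pi\<^sub>M I M)" for s
    by (cases "s \<in> \<Theta>") (simp_all add: E_def)
  have E: "emeasure (Pi\<^sub>M I M) (E s) \<le> ennreal (exp (- z))" if "(s - \<theta>)\<^sup>2 = \<delta>\<^sup>2" for s
  proof (cases "s \<in> \<Theta>")
    case True
    have "emeasure (Pi\<^sub>M I M) (E s) \<le> ennreal (exp (- (N * kullback P q s \<theta>)))"
      using chernoff_bound[OF \<open>\<theta> \<in> \<Theta>\<close> True \<open>finite I\<close> prob X law a] True
      by (simp add: E_def S_def N(1))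
    also have "\<dots> \<le> ennreal (exp (- z))"
    proof -
      have "N * (c * (s - \<theta>)\<^sup>2) \<le> N * kullback P q s \<theta>"
        using N c[OF True] by (intro mult_left_mono) auto
      then show ?thesis using \<delta> that by (simp add: ennreal_leI mult_ac)
    qed
    finally show ?thesis .
  qed (simp add: E_def)
  have incl: "{\<omega>\<in>space (Pi\<^sub>M I M). z < c * N * (t \<omega> - \<theta>)\<^sup>2} \<subseteq> E (\<theta> + \<delta>) \<union> E (\<theta> - \<delta>)"
  proof safe
    fix \<omega> assume \<omega>: "\<omega> \<in> space (Pi\<^sub>M I M)" "z < c * N * (t \<omega> - \<theta>)\<^sup>2" "\<omega> \<notin> E (\<theta> - \<delta>)"
    have "c * N * \<delta>\<^sup>2 < c * N * (t \<omega> - \<theta>)\<^sup>2" using \<omega> \<delta> by simp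
    then have "\<delta>\<^sup>2 < (t \<omega> - \<theta>)\<^sup>2" using N \<open>0 < c\<close> by (simp add: mult_less_cancel_left)
    then have "\<delta> < \<bar>t \<omega> - \<theta>\<bar>" using \<delta>(1) by (metis abs_le_square_iff abs_of_nonneg not_less)
    then consider "\<theta> + \<delta> < t \<omega>" | "t \<omega> < \<theta> - \<delta>" by linarith
    then show "\<omega> \<in> E (\<theta> + \<delta>)"
    proof cases
      case 1
      \<comment> \<open>The estimate lies in \<open>\<Theta>\<close> beyond
        \<open>\<theta> + \<delta>\<close>, so this point is in \<open>\<Theta>\<close> and the
        untruncated mean exceeds it too.\<close>
      then have s: "\<theta> + \<delta> \<in> \<Theta>" "\<theta> + \<delta> < S \<omega> / N"
        using \<open>\<theta> \<in> \<Theta>\<close> \<delta> by (auto simp: \<Theta>_eq t_def)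
      then have "N * (\<theta> + \<delta>) \<le> S \<omega>" using N by (simp add: field_simps)
      moreover have "C \<theta> \<le> C (\<theta> + \<delta>)" using mono_onD[OF C_mono \<open>\<theta> \<in> \<Theta>\<close> s(1)] \<delta> by simp
      ultimately show ?thesis using s \<omega> by (simp add: E_def)
    next
      case 2
      then have s: "\<theta> - \<delta> \<in> \<Theta>" "S \<omega> / N < \<theta> - \<delta>"
        using \<open>\<theta> \<in> \<Theta>\<close> \<delta> by (auto simp: \<Theta>_eq t_def)
      then have "S \<omega> \<le> N * (\<theta> - \<delta>)" using N by (simp add: field_simps)
      moreover have "C (\<theta> - \<delta>) \<le> C \<theta>" using mono_onD[OF C_mono s(1) \<open>\<theta> \<in> \<Theta>\<close>] \<delta> by simp
      ultimately have "\<omega> \<in> E (\<theta> - \<delta>)" using s \<omega> by (simp add: E_def mult_nonpos_nonpos)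
      then show ?thesis using \<omega> by simp
    qed
  qed
  have "emeasure (Pi\<^sub>M I M) {\<omega>\<in>space (Pi\<^sub>M I M). z < c * N * (t \<omega> - \<theta>)\<^sup>2}
      \<le> emeasure (Pi\<^sub>M I M) (E (\<theta> + \<delta>) \<union> E (\<theta> - \<delta>))"
    by (rule emeasure_mono[OF incl]) measurable
  also have "\<dots> \<le> emeasure (Pi\<^sub>M I M) (E (\<theta> + \<delta>)) + emeasure (Pi\<^sub>M I M) (E (\<theta> - \<delta>))"
    by (rule emeasure_subadditive) measurable
  also have "\<dots> \<le> ennreal (exp (- z)) + ennreal (exp (- z))"
    by (intro add_mono E) auto
  also have "\<dots> = ennreal (2 * exp (- z))"
    by (simp add: ennreal_plus[symmetric] del: ennreal_plus)
  finally show "emeasure (Pi\<^sub>M I M)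
      {\<omega>\<in>space (Pi\<^sub>M I M). z < c * N * (max lo (min hi ((\<Sum>i\<in>I. a i * X (\<omega> i)) / N)) - \<theta>)\<^sup>2}
      \<le> ennreal (2 * exp (- z))"
    unfolding t_def S_def .
qed

end

section \<open>The loss of the aggregated estimates\<close>

lemma aggregated_Suc:
  "1 \<le> k \<Longrightarrow> aggregated Kag D N z est (Suc k) =
     Kag (N (Suc k) * D (est (Suc k)) (aggregated Kag D N z est k) / z (Suc k)) * est (Suc k) +
     (1 - Kag (N (Suc k) * D (est (Suc k)) (aggregated Kag D N z est k) / z (Suc k))) *
       aggregated Kag D N z est k"
  by (cases k) (simp_all add: Let_def)

section \<open>Auxiliary inequalities\<close>

lemma abs_convex_comb_le:
  fixes x y t g :: real
  assumes "0 \<le> g" "g \<le> 1" "\<bar>x - t\<bar> \<le> m" "\<bar>y - t\<bar> \<le> m"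
  shows "\<bar>g * x + (1 - g) * y - t\<bar> \<le> m"
proof -
  have "g * x + (1 - g) * y - t = g * (x - t) + (1 - g) * (y - t)" by (simp add: algebra_simps)
  also have "\<bar>\<dots>\<bar> \<le> \<bar>g * (x - t)\<bar> + \<bar>(1 - g) * (y - t)\<bar>" by (rule abs_triangle_ineq)
  also have "\<dots> = g * \<bar>x - t\<bar> + (1 - g) * \<bar>y - t\<bar>" using assms(1,2) by (simp add: abs_mult)
  also have "\<dots> \<le> g * m + (1 - g) * m"
    using assms by (intro add_mono mult_left_mono) auto
  finally show ?thesis by (simp add: algebra_simps)
qed

text \<open>An injective exponent picks distinct terms of one geometric series; \<open>K - j\<close>
  and \<open>l - j\<close> are such exponents.\<close>

lemma sum_power_inj_le:
  fixes v :: real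
  assumes "0 \<le> v" "v < 1" "finite A" "inj_on h A"
  shows "(\<Sum>a\<in>A. v ^ h a) \<le> 1 / (1 - v)"
proof -
  have "(\<Sum>a\<in>A. v ^ h a) = (\<Sum>m\<in>h ` A. v ^ m)" by (simp add: sum.reindex[OF assms(4)])
  also have "\<dots> \<le> (\<Sum>m. v ^ m)"
    using assms by (intro sum_le_suminf summable_geometric) auto
  also have "\<dots> = 1 / (1 - v)" using assms by (intro suminf_geometric) auto
  finally show ?thesis .
qed

text \<open>The bound does not involve \<open>K\<close>, which keeps the final constants free of the
  number of steps.\<close>

lemma sum_power_power_le:
  fixes v :: real
  assumes "0 \<le> v" "v < 1"
  shows "(\<Sum>j\<in>{1..<K}. \<Sum>l\<in>{j..K}. v ^ (K - j) * v ^ (l - j)) \<le> 1 / (1 - v)\<^sup>2"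
proof -
  have "(\<Sum>j\<in>{1..<K}. \<Sum>l\<in>{j..K}. v ^ (K - j) * v ^ (l - j))
      = (\<Sum>j\<in>{1..<K}. v ^ (K - j) * (\<Sum>l\<in>{j..K}. v ^ (l - j)))"
    by (simp add: sum_distrib_left)
  also have "\<dots> \<le> (\<Sum>j\<in>{1..<K}. v ^ (K - j) * (1 / (1 - v)))"
    using assms by (intro sum_mono mult_left_mono sum_power_inj_le) (auto simp: inj_on_def)
  also have "\<dots> = (\<Sum>j\<in>{1..<K}. v ^ (K - j)) * (1 / (1 - v))"
    by (rule sum_distrib_right[symmetric])
  also have "\<dots> \<le> 1 / (1 - v) * (1 / (1 - v))"
    using assms by (intro mult_right_mono sum_power_inj_le) (auto simp: inj_on_def)
  finally show ?thesis by (simp add: power2_eq_square)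
qed

text \<open>This is \<open>t \<le> exp t\<close> at \<open>t = x / (4 * r)\<close>, raised to the
  power \<open>r\<close>. Only a quarter of the exponent is used up.\<close>

lemma powr_le_exp:
  fixes x r :: real
  assumes "0 \<le> x" "0 < r"
  shows "x powr r \<le> (4 * r) powr r * exp (x / 4)"
proof -
  have "x / (4 * r) \<le> exp (x / (4 * r))"
    using exp_ge_add_one_self[of "x / (4 * r)"] by linarith
  then have "(x / (4 * r)) powr r \<le> exp (x / (4 * r)) powr r"
    using assms by (intro powr_mono2) auto
  also have "\<dots> = exp (x / 4)" using assms by (simp add: powr_def)
  finally have "x powr r / (4 * r) powr r \<le> exp (x / 4)"
    using assms by (simp add: powr_divide)
  moreover have "0 < (4 * r) powr r" using assms by simp
  ultimately show ?thesis by (simp add: pos_divide_le_eq mult.commute)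
qed

text \<open>Splits a product of exponentials of two possibly dependent errors into single ones,
  whose means are bounded; no joint law is involved.\<close>

lemma exp_quarter_sum_le: "exp (x / 4 + y / 4) \<le> exp (x / 2) + exp (y / 2 :: real)"
proof (cases "x \<le> y")
  case True
  then have "exp (x / 4 + y / 4) \<le> exp (y / 2)" by simp
  then show ?thesis by (rule add_increasing[rotated]) simp
next
  case False
  then have "exp (x / 4 + y / 4) \<le> exp (x / 2)" by simp
  then show ?thesis by (rule add_increasing2[rotated]) simp
qed

section \<open>Pathwise analysis of the procedure\<close>

text \<open>Here the sample is fixed: \<open>est\<close> is a sequence of numbers and
  \<open>D\<close> a nonnegative function bounded by a multiple of the squared distance.
  \<open>z0\<close> is the part of the critical values common to all steps.\<close>

locale aggregation =
  fixes Kag :: "real \<Rightarrow> real" and D :: "real \<Rightarrow> real \<Rightarrow> real" and N z est :: "nat \<Rightarrow> real"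
    and \<Theta> :: "real set" and K :: nat and b c \<rho> u0 u r z0 \<theta> :: real
  assumes kernel: "aggregation_kernel b Kag"
    and convex_\<Theta>: "convex \<Theta>"
    and \<theta>_mem: "\<theta> \<in> \<Theta>"
    and est_mem: "\<And>k. k \<in> {1..K} \<Longrightarrow> est k \<in> \<Theta>"
    and D_lower: "\<And>s t. s \<in> \<Theta> \<Longrightarrow> t \<in> \<Theta> \<Longrightarrow> 0 \<le> D s t"
    and D_upper: "\<And>s t. s \<in> \<Theta> \<Longrightarrow> t \<in> \<Theta> \<Longrightarrow> D s t \<le> \<rho> * c * (s - t)\<^sup>2"
    and params: "0 < b" "0 < c" "1 \<le> \<rho>" "0 < u0" "u0 \<le> u" "u < 1" "0 < r"
    and N_pos: "\<And>k. k \<in> {1..K} \<Longrightarrow> 0 < N k"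
    and N_ratio: "\<And>k. 1 \<le> k \<Longrightarrow> k < K \<Longrightarrow> u0 * N (Suc k) \<le> N k \<and> N k \<le> u * N (Suc k)"
    and z_pos: "\<And>k. k \<in> {1..K} \<Longrightarrow> 0 < z k"
    and z_eq: "\<And>k. k \<in> {1..K} \<Longrightarrow> z k = z0 + 8 / (b * u0 / (4 * \<rho>)) * r * ln (N K / N k)"
begin

abbreviation (input) agg where "agg \<equiv> aggregated Kag D N z est"

abbreviation (input) weight where "weight k \<equiv> Kag (N (Suc k) * D (est (Suc k)) (agg k) / z (Suc k))"

text \<open>Both claims share one induction: membership makes the divergence nonnegative, and the
  kernel is controlled at nonnegative arguments.\<close>

lemma agg_mem_and_weight:
  assumes "1 \<le> k" "k \<le> K"
  shows "agg k \<in> \<Theta> \<and> (k < K \<longrightarrow> 0 \<le> weight k \<and> weight k \<le> 1)"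
  using assms
proof (induction k rule: dec_induct)
  case base
  then show ?case
    using est_mem[of 1] kernel N_pos[of "Suc 1"] z_pos[of "Suc 1"] est_mem[of "Suc 1"] D_lower
    by (auto simp: aggregation_kernel_def)
next
  case (step k)
  then have IH: "agg k \<in> \<Theta>" "0 \<le> weight k" "weight k \<le> 1" by auto
  have "weight k *\<^sub>R est (Suc k) + (1 - weight k) *\<^sub>R agg k \<in> \<Theta>"
    using IH step est_mem[of "Suc k"] by (intro convexD[OF convex_\<Theta>]) auto
  then have mem: "agg (Suc k) \<in> \<Theta>" using step by (subst aggregated_Suc) auto
  moreover have "0 \<le> weight (Suc k) \<and> weight (Suc k) \<le> 1" if "Suc k < K"
  proof -
    have "0 \<le> N (Suc (Suc k)) * D (est (Suc (Suc k))) (agg (Suc k)) / z (Suc (Suc k))"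
      using that mem N_pos[of "Suc (Suc k)"] z_pos[of "Suc (Suc k)"]
      by (intro divide_nonneg_pos mult_nonneg_nonneg D_lower est_mem) auto
    then show ?thesis using kernel unfolding aggregation_kernel_def by blast
  qed
  ultimately show ?case by blast
qed

text \<open>The index \<open>j\<close> is the last one before \<open>k\<close> with \<open>agg j = est j\<close>.\<close>

lemma agg_cases:
  assumes "1 \<le> k" "k \<le> K"
  shows "agg k = est k \<or> (\<exists>j l. 1 \<le> j \<and> j < k \<and> j \<le> l \<and> l \<le> k \<and>
     b * z (Suc j) < N (Suc j) * D (est (Suc j)) (est j) \<and> \<bar>agg k - \<theta>\<bar> \<le> \<bar>est l - \<theta>\<bar>)"
  using assms
proof (induction k rule: dec_induct)
  case base
  then show ?case by simp
next
  case (step k)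
  have w: "0 \<le> weight k" "weight k \<le> 1" using agg_mem_and_weight[of k] step by auto
  have eq: "agg (Suc k) = weight k * est (Suc k) + (1 - weight k) * agg k"
    using step by (intro aggregated_Suc) simp
  have between: "\<bar>agg (Suc k) - \<theta>\<bar> \<le> max \<bar>est (Suc k) - \<theta>\<bar> \<bar>agg k - \<theta>\<bar>"
    unfolding eq using w by (intro abs_convex_comb_le) auto
  show ?case
  \<comment> \<open>Up to the level \<open>b\<close> the kernel equals one and the new estimate is
    accepted in full.\<close>
  proof (cases "N (Suc k) * D (est (Suc k)) (agg k) \<le> b * z (Suc k)")
    case True
    have "0 \<le> N (Suc k) * D (est (Suc k)) (agg k) / z (Suc k)"
      using step N_pos[of "Suc k"] z_pos[of "Suc k"] agg_mem_and_weight[of k]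
      by (intro divide_nonneg_pos mult_nonneg_nonneg D_lower est_mem) auto
    moreover have "N (Suc k) * D (est (Suc k)) (agg k) / z (Suc k) \<le> b"
      using True z_pos[of "Suc k"] step by (simp add: pos_divide_le_eq)
    ultimately have "weight k = 1" using kernel by (auto simp: aggregation_kernel_def)
    then show ?thesis using eq by simp
  next
    case False
    from step have "agg k = est k \<or> (\<exists>j l. 1 \<le> j \<and> j < k \<and> j \<le> l \<and> l \<le> k \<and>
       b * z (Suc j) < N (Suc j) * D (est (Suc j)) (est j) \<and> \<bar>agg k - \<theta>\<bar> \<le> \<bar>est l - \<theta>\<bar>)"
      by simp
    \<comment> \<open>If \<open>agg k = est k\<close>, the failure at step \<open>Suc k\<close>
      starts a new run with \<open>j = l = k\<close>; otherwise \<open>j\<close> and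
      \<open>l\<close> are inherited.\<close>
    then obtain j l where jl: "1 \<le> j" "j \<le> k" "j \<le> l" "l \<le> k"
      "b * z (Suc j) < N (Suc j) * D (est (Suc j)) (est j)" "\<bar>agg k - \<theta>\<bar> \<le> \<bar>est l - \<theta>\<bar>"
    proof (elim disjE exE conjE, goal_cases)
      case 1
      from 1(2) show ?case using 1(1)[of k k] False step by simp
    next
      case (2 j l)
      then show ?case by (intro 2(1)[of j l]) auto
    qed
    from between have "\<exists>l'. j \<le> l' \<and> l' \<le> Suc k \<and> \<bar>agg (Suc k) - \<theta>\<bar> \<le> \<bar>est l' - \<theta>\<bar>"
    proof (cases "\<bar>est (Suc k) - \<theta>\<bar> \<le> \<bar>agg k - \<theta>\<bar>")
      case True
      then show ?thesis using between jl by (intro exI[of _ l]) auto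
    next
      case False
      then show ?thesis using between jl by (intro exI[of _ "Suc k"]) auto
    qed
    with jl show ?thesis by (metis le_imp_less_Suc)
  qed
qed

lemma N_ratio_power:
  assumes "1 \<le> j" "j \<le> l" "l \<le> K"
  shows "N j \<le> u ^ (l - j) * N l"
  using assms(2,3)
proof (induction l rule: dec_induct)
  case base
  then show ?case by simp
next
  case (step l)
  have "N j \<le> u ^ (l - j) * N l" using step by simp
  also have "\<dots> \<le> u ^ (l - j) * (u * N (Suc l))"
    using N_ratio[of l] step assms params by (intro mult_left_mono) auto
  also have "\<dots> = u ^ (Suc l - j) * N (Suc l)" using step by (simp add: Suc_diff_le)
  finally show ?case .
qed

text \<open>With the scale \<open>c * N l\<close>, the expectation of \<open>exp (err l / 2)\<close>
  in the model is at most \<open>tail_moment\<close>.\<close>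

definition err where "err l = c * N l * (est l - \<theta>)\<^sup>2"

lemma err_nonneg: "l \<in> {1..K} \<Longrightarrow> 0 \<le> err l"
  using N_pos[of l] params by (simp add: err_def)

text \<open>Stands in for a triangle inequality: both points lie within \<open>m\<close> of
  \<open>\<theta>\<close>, so their distance is at most \<open>2 * m\<close>.\<close>

lemma D_le:
  assumes "s \<in> \<Theta>" "t \<in> \<Theta>" "\<bar>s - \<theta>\<bar> \<le> m" "\<bar>t - \<theta>\<bar> \<le> m"
  shows "D s t \<le> 4 * \<rho> * c * m\<^sup>2"
proof -
  have "\<bar>s - t\<bar> \<le> 2 * m" using assms by linarith
  then have "(s - t)\<^sup>2 \<le> (2 * m)\<^sup>2" by (metis abs_ge_zero power2_abs power_mono)
  then have "\<rho> * c * (s - t)\<^sup>2 \<le> \<rho> * c * (2 * m)\<^sup>2" using params by (intro mult_left_mono) auto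
  then show ?thesis using D_upper[OF assms(1,2)] by (simp add: power_mult_distrib)
qed

text \<open>The indices \<open>j\<close> and \<open>l\<close> from \<open>agg_cases\<close> depend
  on the sample, hence the sum over all pairs. The result is linear in exponentials of single errors
  and ready to be integrated.\<close>

lemma loss_le:
  assumes k: "1 \<le> k" "k \<le> K"
  shows "\<bar>N k * D (est k) (agg k)\<bar> powr r \<le>
    (4 * \<rho>) powr r * (4 * r) powr r * u0 powr (- 2 * r) * exp (- (b * u0 / (4 * \<rho>) * z0 / 4)) *
    (\<Sum>j\<in>{1..<K}. \<Sum>l\<in>{j..K}. (u powr r) ^ (K - j) * (u powr r) ^ (l - j) *
       (exp (err j / 2) + exp (err (Suc j) / 2) + exp (err l / 2)))" (is "_ \<le> ?C * ?S")
proof (cases "agg k = est k")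
  case True
  have "est k \<in> \<Theta>" using k by (intro est_mem) auto
  then have "D (est k) (est k) = 0"
    using D_lower[of "est k" "est k"] D_upper[of "est k" "est k"] by simp
  moreover have "0 \<le> ?C * ?S"
    using params by (intro mult_nonneg_nonneg sum_nonneg add_nonneg_nonneg) auto
  ultimately show ?thesis using True by simp
next
  case False
  define \<beta> where "\<beta> = b * u0 / (4 * \<rho>)"
  have \<beta>: "0 < \<beta>" using params by (simp add: \<beta>_def)
  define v where "v = u powr r"
  have v: "0 \<le> v" by (simp add: v_def)
  from False agg_cases[OF k] obtain j l0 where jl0: "1 \<le> j" "j < k" "j \<le> l0" "l0 \<le> k"
    "b * z (Suc j) < N (Suc j) * D (est (Suc j)) (est j)" "\<bar>agg k - \<theta>\<bar> \<le> \<bar>est l0 - \<theta>\<bar>" by blast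
  have agg_mem: "agg k \<in> \<Theta>" using agg_mem_and_weight[OF k] by simp
  \<comment> \<open>Of \<open>l0\<close> and \<open>k\<close>, the index with the larger error
    controls both arguments of the loss.\<close>
  obtain l where l: "j \<le> l" "l \<le> k" "\<bar>est k - \<theta>\<bar> \<le> \<bar>est l - \<theta>\<bar>" "\<bar>agg k - \<theta>\<bar> \<le> \<bar>est l - \<theta>\<bar>"
    using jl0 that[of l0] that[of k] by (cases "\<bar>est k - \<theta>\<bar> \<le> \<bar>est l0 - \<theta>\<bar>") auto
  obtain i where i: "i = j \<or> i = Suc j" "\<bar>est j - \<theta>\<bar> \<le> \<bar>est i - \<theta>\<bar>" "\<bar>est (Suc j) - \<theta>\<bar> \<le> \<bar>est i - \<theta>\<bar>"
    using that[of j] that[of "Suc j"] by (cases "\<bar>est j - \<theta>\<bar> \<le> \<bar>est (Suc j) - \<theta>\<bar>") auto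
  have idx: "k \<in> {1..K}" "j \<in> {1..K}" "Suc j \<in> {1..K}" "l \<in> {1..K}" "i \<in> {1..K}" "K \<in> {1..K}"
    using k jl0 l i by auto
  have NS: "u0 * N (Suc j) \<le> N j" using N_ratio[of j] jl0 k by simp
  \<comment> \<open>Non-acceptance at step \<open>Suc j\<close> compares two weak estimates, so the
    worse of them is off by a multiple of the critical value. The factor \<open>u0\<close> in
    \<open>\<beta>\<close> pays for replacing \<open>N (Suc j)\<close> by
    \<open>N j\<close>.\<close>
  have X_i: "\<beta> * z (Suc j) < err i"
  proof -
    have "b * z (Suc j) < N (Suc j) * (4 * \<rho> * c * \<bar>est i - \<theta>\<bar>\<^sup>2)"
      using jl0(5) D_le[OF est_mem est_mem i(3,2)] idx N_pos[of "Suc j"]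
      by (meson less_le_trans mult_left_mono less_imp_le)
    then have "u0 * (b * z (Suc j)) < u0 * (N (Suc j) * (4 * \<rho> * c * \<bar>est i - \<theta>\<bar>\<^sup>2))"
      using params by (intro mult_strict_left_mono) auto
    also have "\<dots> = u0 * N (Suc j) * (4 * \<rho> * c * \<bar>est i - \<theta>\<bar>\<^sup>2)" by simp
    also have "\<dots> \<le> N i * (4 * \<rho> * c * \<bar>est i - \<theta>\<bar>\<^sup>2)"
    proof (rule mult_right_mono)
      have "u0 * N (Suc j) \<le> 1 * N (Suc j)"
        using params N_pos[OF idx(3)] by (intro mult_right_mono) auto
      then show "u0 * N (Suc j) \<le> N i" using i(1) NS by auto
    qed (use params in auto)
    finally show ?thesis using params by (simp add: \<beta>_def err_def field_simps)
  qed
  define R where "R = N j / N K"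
  have R: "0 < R" using N_pos idx by (simp add: R_def)
  have R_le: "R \<le> u ^ (K - j)"
    using N_ratio_power[of j K] N_pos[OF idx(6)] idx by (simp add: R_def pos_divide_le_eq)
  have N_le: "N k \<le> N K"
  proof -
    have "N k \<le> u ^ (K - k) * N K" using N_ratio_power[of k K] k by simp
    also have "\<dots> \<le> 1 * N K"
      using params N_pos[OF idx(6)] by (intro mult_right_mono power_le_one) auto
    finally show ?thesis by simp
  qed
  have power_swap: "(u ^ m) powr r = v ^ m" for m
    using params by (simp add: v_def powr_realpow[symmetric] powr_powr mult.commute)
  have loss: "N k * D (est k) (agg k) \<le> 4 * \<rho> * (N k / N l) * err l"
  proof -
    have "N k * D (est k) (agg k) \<le> N k * (4 * \<rho> * c * \<bar>est l - \<theta>\<bar>\<^sup>2)"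
      using D_le[OF est_mem agg_mem l(3,4)] idx N_pos[of k] by (intro mult_left_mono) auto
    also have "\<dots> = 4 * \<rho> * (N k / N l) * err l"
      using N_pos[OF idx(4)] by (simp add: err_def)
    finally show ?thesis .
  qed
  \<comment> \<open>The loss is scaled by \<open>N k\<close>, the error by \<open>N l\<close>.
    Passing through \<open>N K\<close> and \<open>N j\<close> costs \<open>R powr (- r)\<close> but
    gains a power of \<open>v\<close>.\<close>
  have ratio: "(N k / N l) powr r \<le> R powr (- r) * v ^ (l - j)"
  proof -
    have "N k / N l \<le> N K / N l"
      using N_le N_pos[OF idx(4)] by (intro divide_right_mono) auto
    also have "\<dots> \<le> N K * (u ^ (l - j) / N j)"
    proof -
      have "1 / N l \<le> u ^ (l - j) / N j"
        using N_ratio_power[of j l] idx l k N_pos[OF idx(2)] N_pos[OF idx(4)]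
        by (simp add: field_simps)
      then show ?thesis using mult_left_mono[of "1 / N l" "u ^ (l - j) / N j" "N K"] N_pos[OF idx(6)] by simp
    qed
    also have "\<dots> = inverse R * u ^ (l - j)" by (simp add: R_def)
    finally have "(N k / N l) powr r \<le> (inverse R * u ^ (l - j)) powr r"
      using N_pos idx params by (intro powr_mono2) (auto simp: less_imp_le)
    then show ?thesis
      using R params by (simp add: powr_mult power_swap powr_minus inverse_powr)
  qed
  \<comment> \<open>A quarter of the coefficient \<open>8 / \<beta>\<close>, times
    \<open>\<beta>\<close>, gives the exponent \<open>2 * r\<close>; \<open>u0\<close> trades
    \<open>N (Suc j)\<close> for \<open>N j\<close>.\<close>
  have exp_z: "exp (- (\<beta> * z (Suc j)) / 4) \<le> exp (- (\<beta> * z0 / 4)) * (u0 powr (- 2 * r) * R powr (2 * r))"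
  proof -
    have "z (Suc j) = z0 + 8 / \<beta> * r * ln (N K / N (Suc j))"
      using z_eq[OF idx(3)] by (simp add: \<beta>_def)
    then have "- (\<beta> * z (Suc j)) / 4 = - (\<beta> * z0 / 4) + (2 * r) * ln (N (Suc j) / N K)"
      using \<beta> N_pos[OF idx(3)] N_pos[OF idx(6)] by (simp add: field_simps ln_div)
    then have "exp (- (\<beta> * z (Suc j)) / 4) = exp (- (\<beta> * z0 / 4)) * (N (Suc j) / N K) powr (2 * r)"
      using N_pos[OF idx(3)] N_pos[OF idx(6)] by (simp add: powr_def exp_add[symmetric])
    also have "(N (Suc j) / N K) powr (2 * r) \<le> (R / u0) powr (2 * r)"
      using NS N_pos[OF idx(3)] N_pos[OF idx(6)] params
      by (intro powr_mono2) (auto simp: R_def field_simps)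
    also have "(R / u0) powr (2 * r) = u0 powr (- 2 * r) * R powr (2 * r)"
      using R params by (simp add: powr_divide powr_minus field_simps)
    finally show ?thesis by simp
  qed
  have le_mult_exp: "x \<le> x * exp t" if "0 \<le> x" "0 \<le> t" for x t :: real
    using mult_left_mono[of 1 "exp t" x] that by simp
  have "\<bar>N k * D (est k) (agg k)\<bar> powr r = (N k * D (est k) (agg k)) powr r"
    using N_pos[OF idx(1)] D_lower[OF est_mem[OF idx(1)] agg_mem] by simp
  also have "\<dots> \<le> (4 * \<rho> * (N k / N l) * err l) powr r"
    using loss N_pos[OF idx(1)] D_lower[OF est_mem[OF idx(1)] agg_mem] params
    by (intro powr_mono2) auto
  also have "\<dots> = (4 * \<rho>) powr r * (N k / N l) powr r * err l powr r"
    using params N_pos[OF idx(1)] N_pos[OF idx(4)] err_nonneg[OF idx(4)]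
    by (simp add: powr_mult del: times_divide_eq_right)
  also have "\<dots> \<le> (4 * \<rho>) powr r * (R powr (- r) * v ^ (l - j)) * ((4 * r) powr r * exp (err l / 4))"
    using ratio powr_le_exp[OF err_nonneg[OF idx(4)]] params v by (intro mult_mono) auto
  \<comment> \<open>By \<open>X_i\<close> the new factor is at least one. This is Markov's
    inequality for the event of non-acceptance, in pathwise form.\<close>
  also have "\<dots> \<le> (4 * \<rho>) powr r * (R powr (- r) * v ^ (l - j)) * ((4 * r) powr r * exp (err l / 4)) *
      exp (err i / 4 + - (\<beta> * z (Suc j)) / 4)"
    by (rule le_mult_exp) (use X_i v in \<open>auto intro!: mult_nonneg_nonneg\<close>)
  also have "\<dots> = (4 * \<rho>) powr r * (4 * r) powr r * v ^ (l - j) * exp (err l / 4 + err i / 4) *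
      (R powr (- r) * exp (- (\<beta> * z (Suc j)) / 4))"
    unfolding exp_add by (simp only: mult_ac)
  also have "\<dots> \<le> (4 * \<rho>) powr r * (4 * r) powr r * v ^ (l - j) * (exp (err i / 2) + exp (err l / 2)) *
      (R powr (- r) * (exp (- (\<beta> * z0 / 4)) * (u0 powr (- 2 * r) * R powr (2 * r))))"
    using exp_z exp_quarter_sum_le[of "err l" "err i"] v
    by (intro mult_mono mult_nonneg_nonneg) (auto simp: add.commute)
  also have "\<dots> = ?C * (R powr r * v ^ (l - j) * (exp (err i / 2) + exp (err l / 2)))"
  proof -
    \<comment> \<open>Half of the power \<open>2 * r\<close> from the critical value cancels
      \<open>R powr (- r)\<close>; the other half survives and decays in
      \<open>K - j\<close>.\<close>
    have "R powr (- r) * R powr (2 * r) = R powr r" by (simp add: powr_add[symmetric])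
    then show ?thesis by (simp add: \<beta>_def)
  qed
  also have "\<dots> \<le> ?C * ?S"
  proof (rule mult_left_mono)
    have "R powr r * v ^ (l - j) * (exp (err i / 2) + exp (err l / 2))
        \<le> v ^ (K - j) * v ^ (l - j) * (exp (err j / 2) + exp (err (Suc j) / 2) + exp (err l / 2))"
    proof (intro mult_mono)
      have "R powr r \<le> (u ^ (K - j)) powr r" using R R_le params by (intro powr_mono2) auto
      then show "R powr r \<le> v ^ (K - j)" by (simp add: power_swap)
      show "exp (err i / 2) + exp (err l / 2) \<le> exp (err j / 2) + exp (err (Suc j) / 2) + exp (err l / 2)"
        using i(1) by auto
    qed (use v in auto)
    also have "\<dots> \<le> (\<Sum>l\<in>{j..K}. v ^ (K - j) * v ^ (l - j) *
       (exp (err j / 2) + exp (err (Suc j) / 2) + exp (err l / 2)))"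
      using l k v by (intro member_le_sum) auto
    also have "\<dots> \<le> ?S"
      unfolding v_def[symmetric]
      using jl0 k v by (intro member_le_sum[of j "{1..<K}" "\<lambda>j. \<Sum>l\<in>{j..K}. v ^ (K - j) * v ^ (l - j) *
       (exp (err j / 2) + exp (err (Suc j) / 2) + exp (err l / 2))"] sum_nonneg) auto
    finally show "R powr r * v ^ (l - j) * (exp (err i / 2) + exp (err l / 2)) \<le> ?S" .
  qed (use params in auto)
  finally show ?thesis .
qed

end

section \<open>The risk of the aggregated estimates\<close>

text \<open>The integrand is \<open>ln 1\<close>, or \<open>ln (0 / 0) = 0\<close> where the density
  vanishes.\<close>

lemma kullback_self: "kullback P q x x = 0"
proof -
  have "ln (a / a) = 0" for a :: real by (cases "a = 0") simp_all
  then show ?thesis by (simp add: kullback_def)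
qed

text \<open>Settles \<open>k = 1\<close> separately. In particular it covers \<open>K = 1\<close>,
  where the scheme does not force \<open>local_size\<close> to be positive.\<close>

lemma aggregation_risk_first: "aggregation_risk r P q \<Theta> n w Kag z 1 M = 0"
  by (simp add: aggregation_risk_def kullback_self)

lemma observation_law_measurable_snd:
  assumes "observation_law d P q f Q"
  shows "snd \<in> borel_measurable Q"
proof -
  have sets_Q: "sets Q = sets (covariate_space d \<Otimes>\<^sub>M borel)"
    using assms by (simp add: observation_law_def)
  show ?thesis unfolding measurable_cong_sets[OF sets_Q refl] by (rule measurable_snd)
qed

text \<open>The conditional law of the response is almost surely \<open>P\<^sub>\<theta>\<close>;
  testing with the full covariate space gives the marginal.\<close>

lemma distr_observation_law:
  assumes "sets P = sets borel" and law: "observation_law d P q f Q" and ae: "AE z in Q. f (fst z) = \<theta>"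
  shows "distr Q borel snd = family_law P q \<theta>"
proof (rule measure_eqI)
  show "sets (distr Q borel snd) = sets (family_law P q \<theta>)"
    using assms by (simp add: family_law_def)
  fix A assume "A \<in> sets (distr Q borel snd)"
  then have A: "A \<in> sets borel" by simp
  interpret prob_space Q using law by (simp add: observation_law_def)
  let ?S = "space (covariate_space d)"
  have "sets Q = sets (covariate_space d \<Otimes>\<^sub>M borel)" using law by (simp add: observation_law_def)
  from sets_eq_imp_space_eq[OF this] have space: "space Q = ?S \<times> UNIV"
    by (simp add: space_pair_measure)
  have "emeasure (distr Q borel snd) A = emeasure Q (snd -` A \<inter> space Q)"
    using observation_law_measurable_snd[OF law] A by (simp add: emeasure_distr)
  also have "snd -` A \<inter> space Q = ?S \<times> A" by (auto simp: space)
  also have "emeasure Q (?S \<times> A)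
      = (\<integral>\<^sup>+z. indicator ?S (fst z) * emeasure (family_law P q (f (fst z))) A \<partial>Q)"
    using law A unfolding observation_law_def by blast
  also have "\<dots> = (\<integral>\<^sup>+z. emeasure (family_law P q \<theta>) A \<partial>Q)"
  proof (rule nn_integral_cong_AE)
    show "AE z in Q. indicator ?S (fst z) * emeasure (family_law P q (f (fst z))) A
        = emeasure (family_law P q \<theta>) A"
      using ae AE_space by eventually_elim (auto simp: space)
  qed
  also have "\<dots> = emeasure (family_law P q \<theta>) A" by (simp add: emeasure_space_1)
  finally show "emeasure (distr Q borel snd) A = emeasure (family_law P q \<theta>) A" .
qed

text \<open>The weights give nonnegativity. A zero size would make a ratio zero, as division by zero
  is zero, against \<open>0 < u0\<close>.\<close>

lemma localizing_scheme_local_size: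
  assumes "0 < u0" "2 \<le> K" and scheme: "localizing_scheme u0 u n K w"
  shows "k \<in> {1..K} \<Longrightarrow> 0 < local_size n w k"
    and "1 \<le> k \<Longrightarrow> k < K \<Longrightarrow> u0 * local_size n w (Suc k) \<le> local_size n w k \<and>
           local_size n w k \<le> u * local_size n w (Suc k)"
proof -
  let ?N = "local_size n w"
  have nonneg: "0 \<le> ?N k" if "k \<in> {1..K}" for k
  proof -
    have "0 \<le> w k i" if "i \<in> {1..n}" for i
      using scheme that \<open>k \<in> {1..K}\<close> unfolding localizing_scheme_def by blast
    then show ?thesis unfolding local_size_def by (rule sum_nonneg)
  qed
  have ratio: "u0 \<le> ?N k / ?N (Suc k) \<and> ?N k / ?N (Suc k) \<le> u" if "1 \<le> k" "k < K" for k
  proof -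
    have "Suc k \<in> {2..K}" using that by auto
    then have "u0 \<le> ?N (Suc k - 1) / ?N (Suc k) \<and> ?N (Suc k - 1) / ?N (Suc k) \<le> u"
      using scheme unfolding localizing_scheme_def by blast
    then show ?thesis by simp
  qed
  have nonzero: "?N k \<noteq> 0 \<and> ?N (Suc k) \<noteq> 0" if "1 \<le> k" "k < K" for k
    using ratio[OF that] \<open>0 < u0\<close> by auto
  show pos: "0 < ?N k" if "k \<in> {1..K}" for k
  proof (cases "k < K")
    case True
    then show ?thesis using nonzero[of k] nonneg[OF that] that by auto
  next
    case False
    \<comment> \<open>The last index has no successor; it is reached as the denominator of the ratio
      at \<open>K - 1\<close>.\<close>
    then have "k = Suc (K - 1)" using that \<open>2 \<le> K\<close> by auto
    then have "?N k \<noteq> 0" using nonzero[of "K - 1"] \<open>2 \<le> K\<close> by auto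
    then show ?thesis using nonneg[OF that] by simp
  qed
  show "u0 * ?N (Suc k) \<le> ?N k \<and> ?N k \<le> u * ?N (Suc k)" if "1 \<le> k" "k < K"
    using ratio[OF that] pos[of "Suc k"] that by (simp add: pos_le_divide_eq pos_divide_le_eq)
qed

section \<open>Integration of the pathwise bound\<close>

context regular_exp_family
begin

text \<open>Integrates \<open>loss_le\<close>. Each of the three exponentials has mean at most
  \<open>tail_moment\<close>, which gives the factor 3, and the double geometric series gives the
  last denominator.\<close>

lemma aggregation_risk_le:
  fixes r u0 u b z0 :: real and M :: "nat \<Rightarrow> ((nat \<Rightarrow> real) \<times> real) measure"
  assumes \<theta>: "\<theta> \<in> \<Theta>"
    and params: "0 < r" "0 < u0" "u0 \<le> u" "u < 1" "0 < b"
    and prob: "\<And>i. i \<in> {1..n} \<Longrightarrow> prob_space (M i)"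
    and snd_measurable: "\<And>i. i \<in> {1..n} \<Longrightarrow> snd \<in> borel_measurable (M i)"
    and law: "\<And>i. i \<in> {1..n} \<Longrightarrow> distr (M i) borel snd = family_law P q \<theta>"
    and scheme: "localizing_scheme u0 u n K w"
    and kernel: "aggregation_kernel b Kag"
    and K: "2 \<le> K" and k: "k \<in> {1..K}"
    and z_pos: "\<And>k. k \<in> {1..K} \<Longrightarrow> 0 < z k"
    and z_eq: "\<And>k. k \<in> {1..K} \<Longrightarrow>
      z k = z0 + 8 / (b * u0 / (4 * \<kappa> ^ 4)) * r * ln (local_size n w K / local_size n w k)"
  shows "aggregation_risk r P q \<Theta> n w Kag z k (Pi\<^sub>M {1..n} M) \<le>
    ennreal ((4 * \<kappa> ^ 4) powr r * (4 * r) powr r * u0 powr (- 2 * r) *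
      exp (- (b * u0 / (4 * \<kappa> ^ 4) * z0 / 4)) * (3 * tail_moment / (1 - u powr r)\<^sup>2))"
proof -
  define N where "N = local_size n w"
  define v where "v = u powr r"
  define \<rho> where "\<rho> = \<kappa> ^ 4"
  define A where "A = (4 * \<rho>) powr r * (4 * r) powr r * u0 powr (- 2 * r) *
    exp (- (b * u0 / (4 * \<rho>) * z0 / 4))"
  have v: "0 \<le> v" "v < 1"
    using params powr_less_mono2[of r u 1] by (simp_all add: v_def)
  have A_nonneg: "0 \<le> A" using params by (simp add: A_def)
  have \<rho>: "1 \<le> \<rho>" using \<kappa>_ge_1 by (simp add: \<rho>_def)
  have lo_hi: "lo \<le> hi" using \<theta> by (simp add: \<Theta>_eq)
  obtain c where c: "0 < c"
    "\<And>\<theta> s. \<theta> \<in> \<Theta> \<Longrightarrow> s \<in> \<Theta> \<Longrightarrow> c * (\<theta> - s)\<^sup>2 \<le> kullback P q \<theta> s"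
    "\<And>\<theta> s. \<theta> \<in> \<Theta> \<Longrightarrow> s \<in> \<Theta> \<Longrightarrow> kullback P q \<theta> s \<le> \<rho> * c * (\<theta> - s)\<^sup>2"
    using kullback_quadratic unfolding \<rho>_def by blast
  note N_props = localizing_scheme_local_size[OF params(2) K scheme, folded N_def]
  define t where "t l \<omega> = max lo (min hi ((\<Sum>i=1..n. w l i * snd (\<omega> i)) / N l))"
    for l and \<omega> :: "nat \<Rightarrow> (nat \<Rightarrow> real) \<times> real"
  define E where "E l \<omega> = exp (c * N l * (t l \<omega> - \<theta>)\<^sup>2 / 2)" for l and \<omega> :: "nat \<Rightarrow> (nat \<Rightarrow> real) \<times> real"
  let ?M = "Pi\<^sub>M {1..n} M"
  have sum_measurable [measurable]: "(\<lambda>\<omega>. \<Sum>i=1..n. w l i * snd (\<omega> i)) \<in> borel_measurable ?M" for l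
    using snd_measurable
    by (intro borel_measurable_sum borel_measurable_times borel_measurable_const)
      (auto intro: measurable_compose[OF measurable_component_singleton])
  have E_measurable [measurable]: "(\<lambda>\<omega>. ennreal (E l \<omega>)) \<in> borel_measurable ?M" for l
    unfolding E_def t_def by measurable
  have E_int: "(\<integral>\<^sup>+\<omega>. ennreal (E l \<omega>) \<partial>?M) \<le> ennreal tail_moment" if "l \<in> {1..K}" for l
  proof -
    have "0 \<le> w l i" "w l i \<le> 1" if "i \<in> {1..n}" for i
      using scheme that \<open>l \<in> {1..K}\<close> unfolding localizing_scheme_def by blast+
    then show ?thesis
      unfolding E_def t_def
      using N_props(1)[OF that] c
      by (intro nn_integral_exp_mle_error_le[OF \<theta> finite_atLeastAtMost c(1) _ prob snd_measurable law])
        (auto simp: N_def local_size_def \<theta>)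
  qed
  \<comment> \<open>Where \<open>p\<close> vanishes at some observation, the log-likelihood takes
    default values and \<open>local_mle_eq\<close> does not apply; this event is null.\<close>
  have ae: "AE \<omega> in ?M. \<forall>i\<in>{1..n}. 0 < p (snd (\<omega> i))"
  proof (rule AE_finite_allI)
    fix i assume i: "i \<in> {1..n}"
    have "AE x in M i. 0 < p (snd x)"
      using AE_p_pos[OF \<theta>] unfolding law[OF i, symmetric] by (rule AE_distrD[OF snd_measurable[OF i]])
    then show "AE \<omega> in ?M. 0 < p (snd (\<omega> i))"
      using prob i by (intro AE_PiM_component[where P = "\<lambda>x. 0 < p (snd x)"]) auto
  qed simp
  let ?bound = "\<lambda>\<omega>. A * (\<Sum>j\<in>{1..<K}. \<Sum>l\<in>{j..K}. v ^ (K - j) * v ^ (l - j) *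
    (E j \<omega> + E (Suc j) \<omega> + E l \<omega>))"
  have "aggregation_risk r P q \<Theta> n w Kag z k ?M \<le> (\<integral>\<^sup>+\<omega>. ennreal (?bound \<omega>) \<partial>?M)"
    unfolding aggregation_risk_def Let_def
  proof (rule nn_integral_mono_AE, use ae in eventually_elim)
    fix \<omega> :: "nat \<Rightarrow> (nat \<Rightarrow> real) \<times> real"
    assume pos: "\<forall>i\<in>{1..n}. 0 < p (snd (\<omega> i))"
    define est where "est l = local_mle q \<Theta> n (w l) (\<lambda>i. snd (\<omega> i))" for l
    have est_eq: "est l = t l \<omega>" if "l \<in> {1..K}" for l
      unfolding est_def t_def N_def local_size_def
      using N_props(1)[OF that] pos
      by (intro local_mle_eq lo_hi) (auto simp: N_def local_size_def)
    \<comment> \<open>For fixed \<open>\<omega>\<close> the estimates are numbers in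
      \<open>\<Theta>\<close>, and the pathwise analysis applies.\<close>
    interpret aggregation Kag "kullback P q" N z est \<Theta> K b c \<rho> u0 u r z0 \<theta>
    proof
      show "convex \<Theta>" by (simp add: \<Theta>_eq)
      show "est l \<in> \<Theta>" if "l \<in> {1..K}" for l
        using lo_hi by (auto simp: est_eq[OF that] t_def \<Theta>_eq)
    qed (use \<theta> kernel params c \<rho> kullback_nonneg N_props z_pos z_eq in \<open>auto simp: N_def \<rho>_def\<close>)
    have err: "exp (err l / 2) = E l \<omega>" if "l \<in> {1..K}" for l
      using est_eq[OF that] by (simp add: err_def E_def)
    have "\<bar>N k * kullback P q (est k) (aggregated Kag (kullback P q) N z est k)\<bar> powr r \<le>
        A * (\<Sum>j\<in>{1..<K}. \<Sum>l\<in>{j..K}. v ^ (K - j) * v ^ (l - j) *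
          (exp (err j / 2) + exp (err (Suc j) / 2) + exp (err l / 2)))"
      using loss_le[of k] k unfolding A_def v_def by auto
    also have "\<dots> = ?bound \<omega>"
      by (intro arg_cong2[where f = "(*)"] refl sum.cong) (auto simp: err)
    finally show "ennreal (\<bar>local_size n w k * kullback P q
          (local_mle q \<Theta> n (w k) (\<lambda>i. snd (\<omega> i)))
          (aggregated Kag (kullback P q) (local_size n w) z (\<lambda>j. local_mle q \<Theta> n (w j) (\<lambda>i. snd (\<omega> i))) k)\<bar> powr r)
        \<le> ennreal (?bound \<omega>)"
      unfolding N_def est_def by (rule ennreal_leI)
  qed
  \<comment> \<open>Passing to \<open>ennreal\<close> termwise makes integration linear with
    measurability alone.\<close>
  also have "\<dots> = (\<integral>\<^sup>+\<omega>. (\<Sum>j\<in>{1..<K}. \<Sum>l\<in>{j..K}. ennreal (A * (v ^ (K - j) * v ^ (l - j))) *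
      (ennreal (E j \<omega>) + ennreal (E (Suc j) \<omega>) + ennreal (E l \<omega>))) \<partial>?M)"
  proof (rule nn_integral_cong)
    fix \<omega> :: "nat \<Rightarrow> (nat \<Rightarrow> real) \<times> real"
    have E_nonneg: "0 \<le> E l \<omega>" for l by (simp add: E_def)
    show "ennreal (?bound \<omega>) = (\<Sum>j\<in>{1..<K}. \<Sum>l\<in>{j..K}. ennreal (A * (v ^ (K - j) * v ^ (l - j))) *
      (ennreal (E j \<omega>) + ennreal (E (Suc j) \<omega>) + ennreal (E l \<omega>)))"
      using A_nonneg v E_nonneg
      by (simp add: ennreal_plus[symmetric] ennreal_mult[symmetric] sum_ennreal sum_nonneg
          sum_distrib_left mult.assoc del: ennreal_plus)
  qed
  also have "\<dots> = (\<Sum>j\<in>{1..<K}. \<Sum>l\<in>{j..K}. ennreal (A * (v ^ (K - j) * v ^ (l - j))) *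
      ((\<integral>\<^sup>+\<omega>. ennreal (E j \<omega>) \<partial>?M) + (\<integral>\<^sup>+\<omega>. ennreal (E (Suc j) \<omega>) \<partial>?M) + (\<integral>\<^sup>+\<omega>. ennreal (E l \<omega>) \<partial>?M)))"
    by (simp add: nn_integral_sum nn_integral_cmult nn_integral_add E_measurable del: One_nat_def)
  also have "\<dots> \<le> (\<Sum>j\<in>{1..<K}. \<Sum>l\<in>{j..K}. ennreal (A * (v ^ (K - j) * v ^ (l - j))) *
      (ennreal tail_moment + ennreal tail_moment + ennreal tail_moment))"
    by (intro sum_mono mult_left_mono add_mono E_int) auto
  also have "\<dots> = ennreal (A * (3 * tail_moment) *
      (\<Sum>j\<in>{1..<K}. \<Sum>l\<in>{j..K}. v ^ (K - j) * v ^ (l - j)))"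
    using A_nonneg v tail_moment_pos
    by (simp add: ennreal_plus[symmetric] ennreal_mult[symmetric] sum_ennreal sum_nonneg
        sum_distrib_left mult_ac del: ennreal_plus)
  also have "\<dots> \<le> ennreal (A * (3 * tail_moment) * (1 / (1 - v)\<^sup>2))"
    using A_nonneg v tail_moment_pos
    by (intro ennreal_leI mult_left_mono sum_power_power_le) auto
  finally show ?thesis by (simp add: A_def v_def \<rho>_def)
qed

end

section \<open>Choice of the constants\<close>

text \<open>The witnesses are \<open>4 / \<beta> * ln L\<close>, \<open>4 / \<beta>\<close> and
  \<open>8 / \<beta>\<close>. Besides \<open>r\<close>, \<open>u0\<close> and \<open>u\<close> they
  involve \<open>\<kappa>\<close> and \<open>b\<close>, but neither the family nor the design, the
  weights or \<open>\<alpha>\<close>.\<close>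

theorem theorem5p1:
  fixes r u0 u \<kappa> b :: real
  assumes "0 < r" and "0 < u0" and "u0 \<le> u" and "u < 1"
    and "1 \<le> \<kappa>" and "0 < b"
  shows "\<exists>a0>0. \<exists>a1>0. \<exists>a2>0.
    \<forall>(P :: real measure) (q :: real \<Rightarrow> real \<Rightarrow> real) (\<Theta> :: real set)
      (d :: nat) (n :: nat) (K :: nat) (w :: nat \<Rightarrow> nat \<Rightarrow> real) (Kag :: real \<Rightarrow> real)
      (f :: real \<Rightarrow> (nat \<Rightarrow> real) \<Rightarrow> real)
      (Q :: real \<Rightarrow> nat \<Rightarrow> ((nat \<Rightarrow> real) \<times> real) measure) (\<alpha> :: real).
      dominated_family P q \<Theta> \<longrightarrow>
      exponential_family P q \<Theta> \<longrightarrow>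
      fisher_regular \<kappa> P q \<Theta> \<longrightarrow>
      1 \<le> K \<longrightarrow>
      localizing_scheme u0 u n K w \<longrightarrow>
      aggregation_kernel b Kag \<longrightarrow>
      homogeneous_model d n P q \<Theta> f Q \<longrightarrow>
      0 < \<alpha> \<longrightarrow>
      (\<forall>k\<in>{1..K}. 0 < critical_value a0 a1 a2 r \<alpha> n w K k) \<longrightarrow>
      (\<forall>k\<in>{1..K}.
         (SUP \<theta>\<in>\<Theta>. aggregation_risk r P q \<Theta> n w Kag (critical_value a0 a1 a2 r \<alpha> n w K) k
                     (\<Pi>\<^sub>M i\<in>{1..n}. Q \<theta> i))
         \<le> ennreal (\<alpha> * tau r)) \<and>
      (\<forall>\<theta>\<in>\<Theta>. aggregation_risk r P q \<Theta> n w Kag (critical_value a0 a1 a2 r \<alpha> n w K) K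
                     (\<Pi>\<^sub>M i\<in>{1..n}. Q \<theta> i)
         \<le> ennreal (\<alpha> * tau r))"
proof -
  define \<beta> where "\<beta> = b * u0 / (4 * \<kappa> ^ 4)"
  define G where "G = (4 * \<kappa> ^ 4) powr r * (4 * r) powr r * u0 powr (- 2 * r) *
    (3 * tail_moment / (1 - u powr r)\<^sup>2)"
  \<comment> \<open>The lower bound 2 makes \<open>ln L\<close>, hence \<open>a0\<close>,
    positive.\<close>
  define L where "L = max 2 (G / tau r)"
  have \<beta>: "0 < \<beta>" using assms by (simp add: \<beta>_def)
  have tau: "0 < tau r" using assms by (simp add: tau_def Gamma_real_pos)
  have G: "G \<le> L * tau r" using tau by (simp add: L_def max_def field_simps)
  \<comment> \<open>Together with \<open>4 / \<beta>\<close> in front of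
    \<open>ln (1 / \<alpha>)\<close> this makes \<open>exp (- (\<beta> * z0 / 4))\<close> equal to
    \<open>\<alpha> / L\<close>.\<close>
  define a0 where "a0 = 4 / \<beta> * ln L"
  have "0 < a0" "0 < 4 / \<beta>" "0 < 8 / \<beta>" using \<beta> by (simp_all add: a0_def L_def)
  moreover have "(\<forall>k\<in>{1..K}.
         (SUP \<theta>\<in>\<Theta>. aggregation_risk r P q \<Theta> n w Kag (critical_value a0 (4 / \<beta>) (8 / \<beta>) r \<alpha> n w K) k
                     (\<Pi>\<^sub>M i\<in>{1..n}. Q \<theta> i))
         \<le> ennreal (\<alpha> * tau r)) \<and>
      (\<forall>\<theta>\<in>\<Theta>. aggregation_risk r P q \<Theta> n w Kag (critical_value a0 (4 / \<beta>) (8 / \<beta>) r \<alpha> n w K) K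
                     (\<Pi>\<^sub>M i\<in>{1..n}. Q \<theta> i)
         \<le> ennreal (\<alpha> * tau r))"
    if H: "dominated_family P q \<Theta>" "exponential_family P q \<Theta>" "fisher_regular \<kappa> P q \<Theta>" "1 \<le> K"
      "localizing_scheme u0 u n K w" "aggregation_kernel b Kag" "homogeneous_model d n P q \<Theta> f Q" "0 < \<alpha>"
      "\<forall>k\<in>{1..K}. 0 < critical_value a0 (4 / \<beta>) (8 / \<beta>) r \<alpha> n w K k"
    for P q \<Theta> d n K w Kag f Q \<alpha>
  proof -
    have risk: "aggregation_risk r P q \<Theta> n w Kag (critical_value a0 (4 / \<beta>) (8 / \<beta>) r \<alpha> n w K) k
        (\<Pi>\<^sub>M i\<in>{1..n}. Q \<theta> i) \<le> ennreal (\<alpha> * tau r)" if \<theta>: "\<theta> \<in> \<Theta>" and k: "k \<in> {1..K}" for \<theta> k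
    proof (cases "k = 1")
      case True
      then show ?thesis using aggregation_risk_first by simp
    next
      case False
      from H(2) obtain p B C where pBC: "\<And>y. 0 \<le> p y" "mono_on \<Theta> C"
          "continuously_differentiable_on \<Theta> B" "continuously_differentiable_on \<Theta> C"
          "\<And>\<theta> y. \<theta> \<in> \<Theta> \<Longrightarrow> q y \<theta> = p y * exp (y * C \<theta> - B \<theta>)"
        unfolding exponential_family_def by blast
      from pBC(3) obtain B' where B': "\<And>t. t \<in> \<Theta> \<Longrightarrow> (B has_real_derivative B' t) (at t within \<Theta>)"
        unfolding continuously_differentiable_on_def by blast
      from pBC(4) obtain C' where C': "\<And>t. t \<in> \<Theta> \<Longrightarrow> (C has_real_derivative C' t) (at t within \<Theta>)"
        unfolding continuously_differentiable_on_def by blast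
      have "compact \<Theta>" "convex \<Theta>" using H(3) by (auto simp: fisher_regular_def)
      then obtain lo hi where \<Theta>: "\<Theta> = {lo..hi}"
        using connected_compact_interval_1 convex_connected by blast
      interpret regular_exp_family P q \<Theta> p B C lo hi \<kappa> B' C'
        using H pBC B' C' \<Theta> assms by unfold_locales (auto simp: exponential_family_def)
      have model: "observation_law d P q (f \<theta>) (Q \<theta> i)" "AE z in Q \<theta> i. f \<theta> (fst z) = \<theta>"
        if "i \<in> {1..n}" for i
        using H(7) \<theta> that unfolding homogeneous_model_def by blast+
      define z0 where "z0 = a0 + 4 / \<beta> * ln (1 / \<alpha>)"
      have "aggregation_risk r P q \<Theta> n w Kag (critical_value a0 (4 / \<beta>) (8 / \<beta>) r \<alpha> n w K) k
          (\<Pi>\<^sub>M i\<in>{1..n}. Q \<theta> i) \<le>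
        ennreal ((4 * \<kappa> ^ 4) powr r * (4 * r) powr r * u0 powr (- 2 * r) *
          exp (- (b * u0 / (4 * \<kappa> ^ 4) * z0 / 4)) * (3 * tail_moment / (1 - u powr r)\<^sup>2))"
      proof (rule aggregation_risk_le[OF \<theta> assms(1-4,6)])
        show "prob_space (Q \<theta> i)" if "i \<in> {1..n}" for i
          using model(1)[OF that] by (simp add: observation_law_def)
        show "snd \<in> borel_measurable (Q \<theta> i)" if "i \<in> {1..n}" for i
          using model(1)[OF that] by (rule observation_law_measurable_snd)
        show "distr (Q \<theta> i) borel snd = family_law P q \<theta>" if "i \<in> {1..n}" for i
          using sets_P model[OF that] by (rule distr_observation_law)
        show "2 \<le> K" using False k by auto
      qed (use H k in \<open>auto simp: critical_value_def z0_def \<beta>_def\<close>)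
      also have "\<dots> = ennreal (exp (- (\<beta> * z0 / 4)) * G)"
        by (simp add: G_def \<beta>_def mult_ac)
      also have "exp (- (\<beta> * z0 / 4)) = \<alpha> / L"
      proof -
        have "0 < L" by (simp add: L_def)
        moreover have "- (\<beta> * z0 / 4) = ln \<alpha> - ln L"
          using \<beta> \<open>0 < \<alpha>\<close> by (simp add: z0_def a0_def field_simps ln_div)
        ultimately show ?thesis using \<open>0 < \<alpha>\<close> by (simp add: exp_diff)
      qed
      also have "ennreal (\<alpha> / L * G) \<le> ennreal (\<alpha> * tau r)"
      proof (rule ennreal_leI)
        have "0 < L" by (simp add: L_def)
        then show "\<alpha> / L * G \<le> \<alpha> * tau r"
          using G mult_left_mono[OF G, of "\<alpha> / L"] \<open>0 < \<alpha>\<close> by simp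
      qed
      finally show ?thesis .
    qed
    then show ?thesis using H(4) by (auto intro!: SUP_least)
  qed
  ultimately show ?thesis by (intro exI conjI) blast+
qed

end
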